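(* Let $\Bbbk$ be a commutative ring, let $X$ be a finite set, let $W=W(X)$ be the free monoid on $X$ endowed with an admissible $\mathbb N$-order, and let $S$ be a monic subset of $\Bbbk\langle\!\langle X\rangle\!\rangle$. Set $A:=\Bbbk\langle\!\langle X\rangle\!\rangle/\overline{(S)}$, $\beta(S):=W\setminus W\,\mathsf{mt}(S)\,W$, and let $\varphi:\Bbbk\langle\!\langle X\rangle\!\rangle\to A$ be the projection. Then the following statements are equivalent: (1) $S$ is a Gröbner–Shirshov basis; (2) every composition of elements of $S$ with respect to a word $w$ is trivial modulo $(S,w)$; (3) if $f\in\overline{(S)}\setminus0$ and $w\in W$ satisfies $w<\mathsf{mt}(f)$, then $f$ is trivial modulo $(S,w)$; (4) $(\varphi(w))_{w\in\beta(S)}$ is a topological basis of $A$.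
   Context: $\Bbbk\langle\!\langle X\rangle\!\rangle$ is the algebra of non-commutative formal power series $\sum_{w\in W}\alpha_w w$, with augmentation the constant coefficient, augmentation ideal $I$ (its kernel), and the $I$-adic topology. $\overline{(S)}$ is the closure of the two-sided ideal generated by $S$. $A$ has the quotient topology (basic neighbourhoods of $0$ are the $\varphi(I^n)$), and $\Bbbk$ is discrete. An order on a monoid is admissible if it is total, $1<m$ for all $m\neq1$, and $m_1<m_2$ implies $m'm_1m''<m'm_2m''$ for all $m',m''$. An $\mathbb N$-order is a total order in which every subset bounded above is finite. For $f=\sum f_ww\neq0$, $\mathsf{mt}(f)$ is the minimal word $w$ with $f_w\neq0$; $f$ is monic if $f_{\mathsf{mt}(f)}=1$; a set is monic if all its elements are. $\mathsf{mt}(T)=\{\mathsf{mt}(t):t\in T\}$. A monic set $S$ is a Gröbner–Shirshov basis if $\mathsf{mt}(\overline{(S)}\setminus0)=W\,\mathsf{mt}(S)\,W$. Compositions of monic $f,g$ with respect to $w\in W$: if $w=\mathsf{mt}(f)u=v\,\mathsf{mt}(g)$ with $u,v\in W\setminus\{1\}$, then $fu-vg$ is the intersection composition; if $w=\mathsf{mt}(f)=u\,\mathsf{mt}(g)\,v$ with $u,v\in W$, then $f-ugv$ is the inclusion composition. $f$ is trivial modulo $(S,w)$ if $f$ is a topological sum $f=\sum_{i\in\mathbb N}g_is_ih_i$ with $s_i\in S$, $g_i,h_i\in\Bbbk\langle\!\langle X\rangle\!\rangle$ and $\mathsf{mt}(g_i)\mathsf{mt}(s_i)\mathsf{mt}(h_i)>w$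 for all $i$ (finite or empty sums are allowed). In a Hausdorff topological $\Bbbk$-module $M$, $m$ is the topological sum of a family $(m_i)_{i\in\mathfrak I}$, written $m=\sum_{i\in\mathfrak I}m_i$, if for every neighbourhood $U$ of $m$ there is a finite $\mathfrak F\subseteq\mathfrak I$ such that $\sum_{i\in\mathfrak F'}m_i\in U$ for every finite $\mathfrak F'$ with $\mathfrak F\subseteq\mathfrak F'\subseteq\mathfrak I$; the family is then called summable. A family $(b_i)_{i\in\mathfrak I}$ is a topological basis of $M$ if every element of $M$ can be written uniquely as $\sum_{i\in\mathfrak I}\alpha_ib_i$ with $\alpha_i\in\Bbbk$ and $(\alpha_ib_i)$ summable. *)

theory Defs
  imports
    "HOL-Algebra.Ideal_Product"
    "HOL-Algebra.Module"
    "HOL-Algebra.QuotRing"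
    "HOL-Analysis.Abstract_Limits"
begin

section \<open>Adic topologies and quotient topologies\<close>

primrec ideal_pow :: "('a, 'b) ring_scheme \<Rightarrow> 'a set \<Rightarrow> nat \<Rightarrow> 'a set" where
  "ideal_pow R I 0 = carrier R"
| "ideal_pow R I (Suc n) = ideal_prod R I (ideal_pow R I n)"

definition adic_topology :: "('a, 'b) ring_scheme \<Rightarrow> 'a set \<Rightarrow> 'a topology" where
  "adic_topology R I =
    topology (\<lambda>U. U \<subseteq> carrier R \<and> (\<forall>x\<in>U. \<exists>n. ideal_pow R I n +>\<^bsub>R\<^esub> x \<subseteq> U))"

lemma (in ring) ideal_pow_is_ideal:
  assumes "ideal I R"
  shows "ideal (ideal_pow R I n) R"
  by (induction n) (auto simp: oneideal assms intro: ideal_prod_is_ideal)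

lemma (in ring) ideal_pow_antimono:
  assumes "ideal I R" "m \<le> n"
  shows "ideal_pow R I n \<subseteq> ideal_pow R I m"
  using assms(2)
proof (induction n rule: dec_induct)
  case (step n)
  then show ?case
    using ideal_prod_inter[OF assms(1) ideal_pow_is_ideal[OF assms(1), of n]] by auto
qed simp

lemma (in ring) openin_adic_topology:
  assumes "ideal I R"
  shows "openin (adic_topology R I) U \<longleftrightarrow>
    U \<subseteq> carrier R \<and> (\<forall>x\<in>U. \<exists>n. ideal_pow R I n +> x \<subseteq> U)"
proof -
  let ?P = "\<lambda>U. U \<subseteq> carrier R \<and> (\<forall>x\<in>U. \<exists>n. ideal_pow R I n +> x \<subseteq> U)"
  have "istopology ?P"
    unfolding istopology_def
  proof (intro conjI allI impI)
    fix A B assume A: "?P A" and B: "?P B"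
    show "A \<inter> B \<subseteq> carrier R" using A by auto
    show "\<forall>x\<in>A \<inter> B. \<exists>n. ideal_pow R I n +> x \<subseteq> A \<inter> B"
    proof
      fix x assume "x \<in> A \<inter> B"
      then obtain m n where "ideal_pow R I m +> x \<subseteq> A" "ideal_pow R I n +> x \<subseteq> B"
        using A B by (metis IntD1 IntD2)
      moreover have "ideal_pow R I (max m n) +> x \<subseteq> ideal_pow R I m +> x"
        "ideal_pow R I (max m n) +> x \<subseteq> ideal_pow R I n +> x"
        using ideal_pow_antimono[OF assms, of m "max m n"]
          ideal_pow_antimono[OF assms, of n "max m n"]
        by (auto simp: a_r_coset_def r_coset_def)
      ultimately show "\<exists>n. ideal_pow R I n +> x \<subseteq> A \<inter> B" by blast
    qed
  next
    fix K assume K: "\<forall>U\<in>K. ?P U"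
    show "\<Union>K \<subseteq> carrier R" using K by auto
    show "\<forall>x\<in>\<Union>K. \<exists>n. ideal_pow R I n +> x \<subseteq> \<Union>K"
      using K by (meson Sup_upper UnionE subset_trans)
  qed
  then show ?thesis
    unfolding adic_topology_def by (simp add: topology_inverse')
qed

definition quotient_topology :: "'a topology \<Rightarrow> ('a \<Rightarrow> 'b) \<Rightarrow> 'b topology" where
  "quotient_topology T q =
    topology (\<lambda>U. U \<subseteq> q ` topspace T \<and> openin T {x \<in> topspace T. q x \<in> U})"

lemma openin_quotient_topology:
  "openin (quotient_topology T q) U \<longleftrightarrow>
    U \<subseteq> q ` topspace T \<and> openin T {x \<in> topspace T. q x \<in> U}"
proof -
  have "istopology (\<lambda>U. U \<subseteq> q ` topspace T \<and> openin T {x \<in> topspace T. q x \<in> U})"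
    unfolding istopology_def
  proof (intro conjI allI impI; (elim conjE)?)
    fix A B
    assume "openin T {x \<in> topspace T. q x \<in> A}" "openin T {x \<in> topspace T. q x \<in> B}"
    then have "openin T ({x \<in> topspace T. q x \<in> A} \<inter> {x \<in> topspace T. q x \<in> B})"
      by blast
    also have "{x \<in> topspace T. q x \<in> A} \<inter> {x \<in> topspace T. q x \<in> B} =
        {x \<in> topspace T. q x \<in> A \<inter> B}" by blast
    finally show "openin T {x \<in> topspace T. q x \<in> A \<inter> B}" .
  next
    fix K
    assume "\<forall>U\<in>K. U \<subseteq> q ` topspace T \<and> openin T {x \<in> topspace T. q x \<in> U}"
    then have "openin T (\<Union>U\<in>K. {x \<in> topspace T. q x \<in> U})" by blast
    also have "(\<Union>U\<in>K. {x \<in> topspace T. q x \<in> U}) = {x \<in> topspace T. q x \<in> \<Union>K}"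
      by blast
    finally show "openin T {x \<in> topspace T. q x \<in> \<Union>K}" .
  qed auto
  then show ?thesis
    unfolding quotient_topology_def by (simp add: topology_inverse')
qed

lemma quotient_map_quotient_topology: "quotient_map T (quotient_topology T q) q"
proof -
  have "openin T {x \<in> topspace T. q x \<in> q ` topspace T}"
    by (metis (no_types, lifting) Collect_cong Collect_mem_eq imageI openin_topspace)
  then have "topspace (quotient_topology T q) = q ` topspace T"
    unfolding topspace_def[of "quotient_topology T q"] openin_quotient_topology by blast
  then show ?thesis
    by (auto simp: quotient_map_def openin_quotient_topology)
qed


section \<open>Topological sums and topological bases\<close>

definition has_topological_sum ::
    "('m, 'b) ring_scheme \<Rightarrow> 'm topology \<Rightarrow> ('i \<Rightarrow> 'm) \<Rightarrow> 'i set \<Rightarrow> 'm \<Rightarrow> bool" where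
  "has_topological_sum M T b I m \<longleftrightarrow> limitin T (finsum M b) m (finite_subsets_at_top I)"

lemma has_topological_sum_iff:
  "has_topological_sum M T b I m \<longleftrightarrow>
    m \<in> topspace T \<and>
    (\<forall>U. openin T U \<and> m \<in> U \<longrightarrow>
      (\<exists>F. finite F \<and> F \<subseteq> I \<and>
        (\<forall>F'. finite F' \<and> F \<subseteq> F' \<and> F' \<subseteq> I \<longrightarrow> finsum M b F' \<in> U)))"
  unfolding has_topological_sum_def limitin_def eventually_finite_subsets_at_top ..

text \<open>
  Coefficient families are required to be \<^const>\<open>extensional\<close> so that uniqueness refers only to
  their values on the index set.
\<close>

definition topological_basis_on ::
    "('k, 'm, 'b) module_scheme \<Rightarrow> 'm topology \<Rightarrow> ('i \<Rightarrow> 'm) \<Rightarrow> 'i set \<Rightarrow> bool" where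
  "topological_basis_on M T b I \<longleftrightarrow>
    b \<in> I \<rightarrow> carrier M \<and>
    (\<forall>m\<in>carrier M. \<exists>!\<alpha>. \<alpha> \<in> extensional I \<and>
      has_topological_sum M T (\<lambda>i. \<alpha> i \<odot>\<^bsub>M\<^esub> b i) I m)"

definition quot_algebra :: "('k, 'm, 'b) module_scheme \<Rightarrow> 'm set \<Rightarrow> ('k, 'm set) module" where
  "quot_algebra M J =
    \<lparr>carrier = carrier (M Quot J), monoid.mult = monoid.mult (M Quot J),
      one = one (M Quot J), zero = zero (M Quot J), add = add (M Quot J),
      smult = (\<lambda>a C. \<Union>c\<in>C. J +>\<^bsub>M\<^esub> (a \<odot>\<^bsub>M\<^esub> c))\<rparr>"


section \<open>Non-commutative formal power series\<close>

text \<open>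
  The free monoid on \<open>X\<close> is \<^term>\<open>lists X\<close> with concatenation. A series is its coefficient
  function, extended by zero to lists with letters outside \<open>X\<close>. The sort of the coefficients is
  that of commutative rings with unit without the requirement that \<open>0\<close> and \<open>1\<close> be different.
\<close>

definition ncps ::
    "'x set \<Rightarrow> ('k :: {comm_ring, comm_monoid_mult}, 'x list \<Rightarrow> 'k) module" where
  "ncps X =
    \<lparr>carrier = {f. \<forall>w. w \<notin> lists X \<longrightarrow> f w = 0},
      monoid.mult = (\<lambda>f g w. \<Sum>i\<le>length w. f (take i w) * g (drop i w)),
      one = (\<lambda>w. if w = [] then 1 else 0),
      zero = (\<lambda>w. 0),
      add = (\<lambda>f g w. f w + g w),
      smult = (\<lambda>a f w. a * f w)\<rparr>"

definition word :: "'x list \<Rightarrow> 'x list \<Rightarrow> 'k :: {comm_ring, comm_monoid_mult}" where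
  "word w = (\<lambda>v. if v = w then 1 else 0)"

definition aug_ideal :: "'x set \<Rightarrow> ('x list \<Rightarrow> 'k :: {comm_ring, comm_monoid_mult}) set" where
  "aug_ideal X = {f \<in> carrier (ncps X). f [] = 0}"

definition ncps_topology ::
    "'x set \<Rightarrow> ('x list \<Rightarrow> 'k :: {comm_ring, comm_monoid_mult}) topology" where
  "ncps_topology X = adic_topology (ncps X) (aug_ideal X)"

definition closed_ideal ::
    "'x set \<Rightarrow> ('x list \<Rightarrow> 'k :: {comm_ring, comm_monoid_mult}) set \<Rightarrow> ('x list \<Rightarrow> 'k) set" where
  "closed_ideal X S = ncps_topology X closure_of genideal (ncps X) S"

lemma ring_ncps: "ring (ncps X :: ('k :: {comm_ring, comm_monoid_mult}, 'x list \<Rightarrow> 'k) module)"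
proof -
  let ?P = "ncps X :: ('k, 'x list \<Rightarrow> 'k) module"
  have mult_closed: "f \<otimes>\<^bsub>?P\<^esub> g \<in> carrier ?P" if "f \<in> carrier ?P" "g \<in> carrier ?P" for f g
  proof -
    have "f (take i w) * g (drop i w) = 0" if "w \<notin> lists X" for w i
    proof -
      have "take i w \<notin> lists X \<or> drop i w \<notin> lists X"
        using that by (metis append_in_lists_conv append_take_drop_id)
      then show ?thesis
        using \<open>f \<in> carrier ?P\<close> \<open>g \<in> carrier ?P\<close> by (auto simp: ncps_def)
    qed
    then show ?thesis by (simp add: ncps_def)
  qed
  have assoc: "f \<otimes>\<^bsub>?P\<^esub> g \<otimes>\<^bsub>?P\<^esub> h = f \<otimes>\<^bsub>?P\<^esub> (g \<otimes>\<^bsub>?P\<^esub> h)" for f g h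
  proof
    fix w :: "'x list"
    let ?n = "length w"
    have "(f \<otimes>\<^bsub>?P\<^esub> g \<otimes>\<^bsub>?P\<^esub> h) w =
        (\<Sum>i\<le>?n. \<Sum>j\<le>i. f (take j w) * g (drop j (take i w)) * h (drop i w))"
      by (auto simp: ncps_def sum_distrib_right min_def intro!: sum.cong)
    also have "\<dots> = (\<Sum>(i, j)\<in>(SIGMA i:{..?n}. {..i}).
        f (take j w) * g (drop j (take i w)) * h (drop i w))"
      by (subst sum.Sigma) auto
    also have "\<dots> = (\<Sum>(j, k)\<in>(SIGMA j:{..?n}. {..?n - j}).
        f (take j w) * (g (take k (drop j w)) * h (drop k (drop j w))))"
      by (rule sum.reindex_bij_witness[of _ "\<lambda>(j, k). (j + k, j)" "\<lambda>(i, j). (j, i - j)"])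
        (auto simp: drop_take mult.assoc)
    also have "\<dots> = (\<Sum>j\<le>?n. \<Sum>k\<le>?n - j.
        f (take j w) * (g (take k (drop j w)) * h (drop k (drop j w))))"
      by (subst sum.Sigma) auto
    also have "\<dots> = (f \<otimes>\<^bsub>?P\<^esub> (g \<otimes>\<^bsub>?P\<^esub> h)) w"
      by (auto simp: ncps_def sum_distrib_left intro!: sum.cong)
    finally show "(f \<otimes>\<^bsub>?P\<^esub> g \<otimes>\<^bsub>?P\<^esub> h) w = (f \<otimes>\<^bsub>?P\<^esub> (g \<otimes>\<^bsub>?P\<^esub> h)) w" .
  qed
  have l_one: "\<one>\<^bsub>?P\<^esub> \<otimes>\<^bsub>?P\<^esub> f = f" for f
  proof
    fix w :: "'x list"
    have "(\<one>\<^bsub>?P\<^esub> \<otimes>\<^bsub>?P\<^esub> f) w = (\<Sum>i\<le>length w. if i = 0 then f w else 0)"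
      unfolding ncps_def monoid.simps by (rule sum.cong) auto
    then show "(\<one>\<^bsub>?P\<^esub> \<otimes>\<^bsub>?P\<^esub> f) w = f w" by (simp add: sum.delta)
  qed
  have r_one: "f \<otimes>\<^bsub>?P\<^esub> \<one>\<^bsub>?P\<^esub> = f" for f
  proof
    fix w :: "'x list"
    have "(f \<otimes>\<^bsub>?P\<^esub> \<one>\<^bsub>?P\<^esub>) w = (\<Sum>i\<le>length w. if i = length w then f w else 0)"
      unfolding ncps_def monoid.simps by (rule sum.cong) auto
    then show "(f \<otimes>\<^bsub>?P\<^esub> \<one>\<^bsub>?P\<^esub>) w = f w" by (simp add: sum.delta)
  qed
  show ?thesis
  proof (rule ringI)
    show "abelian_group ?P"
    proof (rule abelian_groupI)
      fix f assume f: "f \<in> carrier ?P"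
      show "\<exists>g\<in>carrier ?P. g \<oplus>\<^bsub>?P\<^esub> f = \<zero>\<^bsub>?P\<^esub>"
        by (rule bexI[of _ "\<lambda>w. - f w"]) (use f in \<open>auto simp: ncps_def\<close>)
    qed (auto simp: ncps_def algebra_simps)
    have "\<one>\<^bsub>?P\<^esub> \<in> carrier ?P" by (auto simp: ncps_def)
    then show "monoid ?P"
      using mult_closed assoc l_one r_one by (intro monoidI) auto
  qed (auto simp: ncps_def algebra_simps sum.distrib)
qed

lemma ideal_aug_ideal:
  "ideal (aug_ideal X) (ncps X :: ('k :: {comm_ring, comm_monoid_mult}, 'x list \<Rightarrow> 'k) module)"
proof -
  let ?P = "ncps X :: ('k, 'x list \<Rightarrow> 'k) module"
  interpret ring ?P by (rule ring_ncps)
  have inv: "(\<ominus>\<^bsub>?P\<^esub> f) = (\<lambda>w. - f w)" if "f \<in> carrier ?P" for f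
    by (rule minus_equality) (use that in \<open>auto simp: ncps_def\<close>)
  show ?thesis
  proof (rule idealI)
    show "subgroup (aug_ideal X) (add_monoid ?P)"
    proof
      fix f :: "'x list \<Rightarrow> 'k" assume "f \<in> aug_ideal X"
      then show "inv\<^bsub>add_monoid ?P\<^esub> f \<in> aug_ideal X"
        using inv[of f] a_inv_closed[of f] by (auto simp: aug_ideal_def a_inv_def)
    qed (auto simp: aug_ideal_def ncps_def)
  next
    fix f g :: "'x list \<Rightarrow> 'k" assume "f \<in> aug_ideal X" "g \<in> carrier ?P"
    then show "g \<otimes>\<^bsub>?P\<^esub> f \<in> aug_ideal X" "f \<otimes>\<^bsub>?P\<^esub> g \<in> aug_ideal X"
      using m_closed[of f g] m_closed[of g f] by (auto simp: aug_ideal_def ncps_def)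
  qed (rule ring_ncps)
qed


section \<open>Monomial orders\<close>

text \<open>An order is given as its reflexive relation; the strict part is \<^term>\<open>r - Id\<close>.\<close>

definition admissible_order :: "'x set \<Rightarrow> 'x list rel \<Rightarrow> bool" where
  "admissible_order X r \<longleftrightarrow>
    linear_order_on (lists X) r \<and>
    (\<forall>m\<in>lists X. m \<noteq> [] \<longrightarrow> ([], m) \<in> r - Id) \<and>
    (\<forall>m\<^sub>1\<in>lists X. \<forall>m\<^sub>2\<in>lists X. (m\<^sub>1, m\<^sub>2) \<in> r - Id \<longrightarrow>
      (\<forall>m'\<in>lists X. \<forall>m''\<in>lists X. (m' @ m\<^sub>1 @ m'', m' @ m\<^sub>2 @ m'') \<in> r - Id))"

definition N_order_on :: "'a set \<Rightarrow> 'a rel \<Rightarrow> bool" where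
  "N_order_on A r \<longleftrightarrow>
    linear_order_on A r \<and>
    (\<forall>B\<subseteq>A. (\<exists>u\<in>A. \<forall>b\<in>B. (b, u) \<in> r) \<longrightarrow> finite B)"

definition mt :: "'x list rel \<Rightarrow> ('x list \<Rightarrow> 'k :: zero) \<Rightarrow> 'x list" where
  "mt r f = (THE w. f w \<noteq> 0 \<and> (\<forall>v. f v \<noteq> 0 \<longrightarrow> (w, v) \<in> r))"

definition monic :: "'x list rel \<Rightarrow> ('x list \<Rightarrow> 'k :: {zero, one}) \<Rightarrow> bool" where
  "monic r f \<longleftrightarrow> f \<noteq> (\<lambda>w. 0) \<and> f (mt r f) = 1"

definition word_ideal :: "'x set \<Rightarrow> 'x list set \<Rightarrow> 'x list set" where
  "word_ideal X M = {u @ m @ v |u m v. u \<in> lists X \<and> m \<in> M \<and> v \<in> lists X}"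


section \<open>Groebner-Shirshov bases\<close>

definition GS_basis ::
    "'x set \<Rightarrow> 'x list rel \<Rightarrow> ('x list \<Rightarrow> 'k :: {comm_ring, comm_monoid_mult}) set \<Rightarrow> bool" where
  "GS_basis X r S \<longleftrightarrow>
    (\<forall>s\<in>S. monic r s) \<and>
    mt r ` (closed_ideal X S - {\<zero>\<^bsub>ncps X\<^esub>}) = word_ideal X (mt r ` S)"

definition intersection_composition ::
    "'x set \<Rightarrow> 'x list rel \<Rightarrow> ('x list \<Rightarrow> 'k :: {comm_ring, comm_monoid_mult}) \<Rightarrow>
      ('x list \<Rightarrow> 'k) \<Rightarrow> 'x list \<Rightarrow> ('x list \<Rightarrow> 'k) \<Rightarrow> bool" where
  "intersection_composition X r f g w c \<longleftrightarrow>
    (\<exists>u\<in>lists X - {[]}. \<exists>v\<in>lists X - {[]}.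
      w = mt r f @ u \<and> w = v @ mt r g \<and>
      c = f \<otimes>\<^bsub>ncps X\<^esub> word u \<ominus>\<^bsub>ncps X\<^esub> word v \<otimes>\<^bsub>ncps X\<^esub> g)"

definition inclusion_composition ::
    "'x set \<Rightarrow> 'x list rel \<Rightarrow> ('x list \<Rightarrow> 'k :: {comm_ring, comm_monoid_mult}) \<Rightarrow>
      ('x list \<Rightarrow> 'k) \<Rightarrow> 'x list \<Rightarrow> ('x list \<Rightarrow> 'k) \<Rightarrow> bool" where
  "inclusion_composition X r f g w c \<longleftrightarrow>
    (\<exists>u\<in>lists X. \<exists>v\<in>lists X.
      w = mt r f \<and> w = u @ mt r g @ v \<and>
      c = f \<ominus>\<^bsub>ncps X\<^esub> word u \<otimes>\<^bsub>ncps X\<^esub> g \<otimes>\<^bsub>ncps X\<^esub> word v)"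

definition is_composition ::
    "'x set \<Rightarrow> 'x list rel \<Rightarrow> ('x list \<Rightarrow> 'k :: {comm_ring, comm_monoid_mult}) \<Rightarrow>
      ('x list \<Rightarrow> 'k) \<Rightarrow> 'x list \<Rightarrow> ('x list \<Rightarrow> 'k) \<Rightarrow> bool" where
  "is_composition X r f g w c \<longleftrightarrow>
    intersection_composition X r f g w c \<or> inclusion_composition X r f g w c"

text \<open>
  The index set \<open>N\<close> is an arbitrary subset of \<open>\<nat>\<close>, so finite and empty sums are included. The
  multipliers are nonzero because \<^const>\<open>mt\<close> is meaningful for nonzero series only.
\<close>

definition trivial_mod ::
    "'x set \<Rightarrow> 'x list rel \<Rightarrow> ('x list \<Rightarrow> 'k :: {comm_ring, comm_monoid_mult}) set \<Rightarrow>
      'x list \<Rightarrow> ('x list \<Rightarrow> 'k) \<Rightarrow> bool" where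
  "trivial_mod X r S w f \<longleftrightarrow>
    (\<exists>(N :: nat set) g s h.
      (\<forall>i\<in>N. s i \<in> S \<and>
        g i \<in> carrier (ncps X) - {\<zero>\<^bsub>ncps X\<^esub>} \<and> h i \<in> carrier (ncps X) - {\<zero>\<^bsub>ncps X\<^esub>} \<and>
        (w, mt r (g i) @ mt r (s i) @ mt r (h i)) \<in> r - Id) \<and>
      has_topological_sum (ncps X) (ncps_topology X)
        (\<lambda>i. g i \<otimes>\<^bsub>ncps X\<^esub> s i \<otimes>\<^bsub>ncps X\<^esub> h i) N f)"

definition quot_proj ::
    "'x set \<Rightarrow> ('x list \<Rightarrow> 'k :: {comm_ring, comm_monoid_mult}) set \<Rightarrow>
      ('x list \<Rightarrow> 'k) \<Rightarrow> ('x list \<Rightarrow> 'k) set" where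
  "quot_proj X S f = closed_ideal X S +>\<^bsub>ncps X\<^esub> f"

end

(*
The chosen multiples u s v of elements of S, one for each reducible word, together with the
irreducible words form a triangular family with respect to the word order. Because only finitely
many words lie below a given one, every series expands uniquely in this family, so it is congruent
modulo the closed ideal to a series supported on irreducible words. This reduces (1), (3) and (4)
to the claim that no nonzero element of the closed ideal is supported on irreducible words.

If all compositions are trivial, then two multiples of elements of S with the same leading word w
differ by a topological combination of multiples with leading words larger than w. Hence an element
of the closed ideal can be rewritten with ever larger leading words, until its own leading word is
reached, and that word must then be the leading word of some multiple.
*)
theory Submission
  imports Defs
begin

section \<open>Coefficients of formal power series\<close>

text \<open>The topology measures length, while leading words are compared by \<open>r\<close>, and
  \<open>r\<close> need not refine length. The two are reconciled by a finiteness statement,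
  \<open>finite_le_short\<close>: for each n, only finitely many words lie below some word of length
  less than n. Rewriting takes place in closed linear spans and not in topological sums. An element
  of the closed ideal is known only through approximations, and replacing infinitely many terms of a
  summable family at once would call for a rearrangement argument. Membership in a closed span
  passes to limits, so one word can be treated at a time, and only finitely many words have to be
  passed before \<open>mt r f\<close> is reached. Explicit sums return only for normal forms, where
  the family is under control. Division never occurs: leading coefficients equal to 1 keep every
  triangular system solvable over an arbitrary commutative ring.\<close>

lemma ncps_carrier_iff: "f \<in> carrier (ncps X) \<longleftrightarrow> (\<forall>w. w \<notin> lists X \<longrightarrow> f w = 0)"
  by (simp add: ncps_def)

lemma ncps_carrierD: "f \<in> carrier (ncps X) \<Longrightarrow> f w \<noteq> 0 \<Longrightarrow> w \<in> lists X"
  by (auto simp: ncps_def)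

lemma ncps_simps [simp]:
  "\<zero>\<^bsub>ncps X\<^esub> = (\<lambda>w. 0)"
  "f \<oplus>\<^bsub>ncps X\<^esub> g = (\<lambda>w. f w + g w)"
  "a \<odot>\<^bsub>ncps X\<^esub> f = (\<lambda>w. a * f w)"
  by (auto simp: ncps_def)

lemma ncps_mult: "(f \<otimes>\<^bsub>ncps X\<^esub> g) w = (\<Sum>i\<le>length w. f (take i w) * g (drop i w))"
  by (simp add: ncps_def)

lemma ncps_closed [simp, intro]:
  fixes f g :: "'x list \<Rightarrow> 'k :: {comm_ring, comm_monoid_mult}"
  assumes "f \<in> carrier (ncps X)"
  shows ncps_smult_closed: "(\<lambda>w. a * f w) \<in> carrier (ncps X)"
    and ncps_uminus_closed: "(\<lambda>w. - f w) \<in> carrier (ncps X)"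
    and ncps_add_closed: "g \<in> carrier (ncps X) \<Longrightarrow> (\<lambda>w. f w + g w) \<in> carrier (ncps X)"
    and ncps_diff_closed: "g \<in> carrier (ncps X) \<Longrightarrow> (\<lambda>w. f w - g w) \<in> carrier (ncps X)"
    and ncps_mult_closed: "g \<in> carrier (ncps X) \<Longrightarrow> f \<otimes>\<^bsub>ncps X\<^esub> g \<in> carrier (ncps X)"
proof -
  interpret ring "ncps X :: ('k, 'x list \<Rightarrow> 'k) module" by (rule ring_ncps)
  show "g \<in> carrier (ncps X) \<Longrightarrow> f \<otimes>\<^bsub>ncps X\<^esub> g \<in> carrier (ncps X)"
    using assms by blast
qed (use assms in \<open>auto simp: ncps_carrier_iff\<close>)

lemma ncps_zero_closed [simp, intro]: "(\<lambda>w. 0) \<in> carrier (ncps X)"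
  by (simp add: ncps_carrier_iff)

lemma ncps_sum_closed:
  "(\<And>i. i \<in> F \<Longrightarrow> b i \<in> carrier (ncps X)) \<Longrightarrow> (\<lambda>w. \<Sum>i\<in>F. b i w) \<in> carrier (ncps X)"
  by (simp add: ncps_carrier_iff)

lemma ncps_uminus:
  fixes f :: "'x list \<Rightarrow> 'k :: {comm_ring, comm_monoid_mult}"
  assumes "f \<in> carrier (ncps X)"
  shows "\<ominus>\<^bsub>ncps X\<^esub> f = (\<lambda>w. - f w)"
proof -
  interpret ring "ncps X :: ('k, 'x list \<Rightarrow> 'k) module" by (rule ring_ncps)
  show ?thesis by (rule minus_equality) (use assms in auto)
qed

lemma ncps_minus:
  fixes f g :: "'x list \<Rightarrow> 'k :: {comm_ring, comm_monoid_mult}"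
  assumes "g \<in> carrier (ncps X)"
  shows "f \<ominus>\<^bsub>ncps X\<^esub> g = (\<lambda>w. f w - g w)"
  using ncps_uminus[OF assms] by (simp add: a_minus_def)

lemma ncps_finsum:
  fixes b :: "'i \<Rightarrow> 'x list \<Rightarrow> 'k :: {comm_ring, comm_monoid_mult}"
  assumes "finite F" "b \<in> F \<rightarrow> carrier (ncps X)"
  shows "finsum (ncps X) b F = (\<lambda>w. \<Sum>i\<in>F. b i w)"
proof -
  interpret ring "ncps X :: ('k, 'x list \<Rightarrow> 'k) module" by (rule ring_ncps)
  show ?thesis using assms by (induction F) (auto simp: finsum_insert Pi_iff)
qed

lemma ncps_mult_assoc:
  fixes f g h :: "'x list \<Rightarrow> 'k :: {comm_ring, comm_monoid_mult}"
  assumes "f \<in> carrier (ncps X)" "g \<in> carrier (ncps X)" "h \<in> carrier (ncps X)"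
  shows "f \<otimes>\<^bsub>ncps X\<^esub> g \<otimes>\<^bsub>ncps X\<^esub> h = f \<otimes>\<^bsub>ncps X\<^esub> (g \<otimes>\<^bsub>ncps X\<^esub> h)"
proof -
  interpret ring "ncps X :: ('k, 'x list \<Rightarrow> 'k) module" by (rule ring_ncps)
  show ?thesis using assms m_assoc by blast
qed

text \<open>Each coefficient of a product is a finite sum of products of coefficients. The rules
  hold for arbitrary coefficient functions and thus serve as unconditional rewrite rules.\<close>

lemma ncps_mult_bilinear:
  fixes f g :: "'x list \<Rightarrow> 'k :: {comm_ring, comm_monoid_mult}"
  shows "(\<lambda>w. f w + f' w) \<otimes>\<^bsub>ncps X\<^esub> g = (\<lambda>w. (f \<otimes>\<^bsub>ncps X\<^esub> g) w + (f' \<otimes>\<^bsub>ncps X\<^esub> g) w)"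
    and "g \<otimes>\<^bsub>ncps X\<^esub> (\<lambda>w. f w + f' w) = (\<lambda>w. (g \<otimes>\<^bsub>ncps X\<^esub> f) w + (g \<otimes>\<^bsub>ncps X\<^esub> f') w)"
    and "(\<lambda>w. f w - f' w) \<otimes>\<^bsub>ncps X\<^esub> g = (\<lambda>w. (f \<otimes>\<^bsub>ncps X\<^esub> g) w - (f' \<otimes>\<^bsub>ncps X\<^esub> g) w)"
    and "g \<otimes>\<^bsub>ncps X\<^esub> (\<lambda>w. f w - f' w) = (\<lambda>w. (g \<otimes>\<^bsub>ncps X\<^esub> f) w - (g \<otimes>\<^bsub>ncps X\<^esub> f') w)"
    and "(\<lambda>w. a * f w) \<otimes>\<^bsub>ncps X\<^esub> g = (\<lambda>w. a * (f \<otimes>\<^bsub>ncps X\<^esub> g) w)"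
    and "g \<otimes>\<^bsub>ncps X\<^esub> (\<lambda>w. a * f w) = (\<lambda>w. a * (g \<otimes>\<^bsub>ncps X\<^esub> f) w)"
    and "(\<lambda>w. 0) \<otimes>\<^bsub>ncps X\<^esub> g = (\<lambda>w. 0)"
    and "g \<otimes>\<^bsub>ncps X\<^esub> (\<lambda>w. 0) = (\<lambda>w. 0)"
  by (auto simp: ncps_mult fun_eq_iff algebra_simps sum.distrib sum_subtractf sum_distrib_left)

lemma ncps_sum_mult:
  fixes g :: "'x list \<Rightarrow> 'k :: {comm_ring, comm_monoid_mult}"
  shows "(\<lambda>w. \<Sum>i\<in>F. b i w) \<otimes>\<^bsub>ncps X\<^esub> g = (\<lambda>w. \<Sum>i\<in>F. (b i \<otimes>\<^bsub>ncps X\<^esub> g) w)"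
    and "g \<otimes>\<^bsub>ncps X\<^esub> (\<lambda>w. \<Sum>i\<in>F. b i w) = (\<lambda>w. \<Sum>i\<in>F. (g \<otimes>\<^bsub>ncps X\<^esub> b i) w)"
proof -
  show "(\<lambda>w. \<Sum>i\<in>F. b i w) \<otimes>\<^bsub>ncps X\<^esub> g = (\<lambda>w. \<Sum>i\<in>F. (b i \<otimes>\<^bsub>ncps X\<^esub> g) w)"
    by (rule ext) (simp add: ncps_mult sum_distrib_right, rule sum.swap)
  show "g \<otimes>\<^bsub>ncps X\<^esub> (\<lambda>w. \<Sum>i\<in>F. b i w) = (\<lambda>w. \<Sum>i\<in>F. (g \<otimes>\<^bsub>ncps X\<^esub> b i) w)"
    by (rule ext) (simp add: ncps_mult sum_distrib_left, rule sum.swap)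
qed

lemma word_in_carrier [simp]: "w \<in> lists X \<Longrightarrow> word w \<in> carrier (ncps X)"
  by (auto simp: word_def ncps_carrier_iff)

section \<open>Products with words\<close>

lemma word_mult_nonprefix:
  assumes "take (length u) w \<noteq> u"
  shows "(word u \<otimes>\<^bsub>ncps X\<^esub> f) w = 0"
proof -
  have "take i w = u \<Longrightarrow> i \<le> length w \<Longrightarrow> False" for i
    using assms by auto
  then show ?thesis
    unfolding ncps_mult by (intro sum.neutral) (auto simp: word_def)
qed

lemma word_mult [simp]: "(word u \<otimes>\<^bsub>ncps X\<^esub> f) (u @ w) = f w"
proof -
  have "take i (u @ w) = u \<longleftrightarrow> i = length u" if "i \<le> length (u @ w)" for i
  proof
    assume "take i (u @ w) = u"
    then have "length (take i (u @ w)) = length u" by simp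
    then show "i = length u" using that by simp
  qed simp
  then have "(word u \<otimes>\<^bsub>ncps X\<^esub> f) (u @ w) = (\<Sum>i\<le>length (u @ w). if i = length u then f w else 0)"
    unfolding ncps_mult by (intro sum.cong) (auto simp: word_def)
  then show ?thesis by simp
qed

lemma mult_word_nonsuffix:
  assumes "drop (length w - length u) w \<noteq> u"
  shows "(f \<otimes>\<^bsub>ncps X\<^esub> word u) w = 0"
proof -
  have "drop i w = u \<Longrightarrow> i \<le> length w \<Longrightarrow> False" for i
    using assms by auto
  then show ?thesis
    unfolding ncps_mult by (intro sum.neutral) (auto simp: word_def)
qed

lemma mult_word [simp]: "(f \<otimes>\<^bsub>ncps X\<^esub> word u) (w @ u) = f w"
proof -
  have "drop i (w @ u) = u \<longleftrightarrow> i = length w" if "i \<le> length (w @ u)" for i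
  proof
    assume "drop i (w @ u) = u"
    then have "length (drop i (w @ u)) = length u" by simp
    then show "i = length w" using that by simp
  qed simp
  then have "(f \<otimes>\<^bsub>ncps X\<^esub> word u) (w @ u) = (\<Sum>i\<le>length (w @ u). if i = length w then f w else 0)"
    unfolding ncps_mult by (intro sum.cong) (auto simp: word_def)
  then show ?thesis by simp
qed

lemma word_Nil: "word [] = \<one>\<^bsub>ncps X\<^esub>"
  by (auto simp: word_def ncps_def)

lemma ncps_one_mult [simp]:
  fixes f :: "'x list \<Rightarrow> 'k :: {comm_ring, comm_monoid_mult}"
  assumes "f \<in> carrier (ncps X)"
  shows "\<one>\<^bsub>ncps X\<^esub> \<otimes>\<^bsub>ncps X\<^esub> f = f" "f \<otimes>\<^bsub>ncps X\<^esub> \<one>\<^bsub>ncps X\<^esub> = f"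
proof -
  interpret ring "ncps X :: ('k, 'x list \<Rightarrow> 'k) module" by (rule ring_ncps)
  show "\<one>\<^bsub>ncps X\<^esub> \<otimes>\<^bsub>ncps X\<^esub> f = f" "f \<otimes>\<^bsub>ncps X\<^esub> \<one>\<^bsub>ncps X\<^esub> = f"
    using assms by auto
qed

lemma word_mult_word:
  "word u \<otimes>\<^bsub>ncps X\<^esub> word v = (word (u @ v) :: 'x list \<Rightarrow> 'k :: {comm_ring, comm_monoid_mult})"
proof
  fix w
  show "(word u \<otimes>\<^bsub>ncps X\<^esub> word v) w = (word (u @ v) w :: 'k)"
  proof (cases "take (length u) w = u")
    case True
    then have w: "w = u @ drop (length u) w" by (metis append_take_drop_id)
    show ?thesis by (subst w, subst word_mult) (use w in \<open>auto simp: word_def\<close>)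
  next
    case False
    then have "w \<noteq> u @ v" by auto
    with word_mult_nonprefix[OF False, of X "word v"] show ?thesis
      by (simp add: word_def[of "u @ v"])
  qed
qed

abbreviation shift :: "'x set \<Rightarrow> 'x list \<Rightarrow> ('x list \<Rightarrow> 'k :: {comm_ring, comm_monoid_mult}) \<Rightarrow>
    'x list \<Rightarrow> 'x list \<Rightarrow> 'k" where
  "shift X u f v \<equiv> word u \<otimes>\<^bsub>ncps X\<^esub> f \<otimes>\<^bsub>ncps X\<^esub> word v"

lemma shift_apply: "shift X u f v (u @ w @ v) = f w"
  by (metis append.assoc mult_word word_mult)

text \<open>The support of \<open>u f v\<close> consists of the words u y v with y in the support of
  f. The product associates to the left, so the suffix v is split off before the prefix u.\<close>

lemma shift_nonzeroD:
  assumes "shift X u f v w \<noteq> 0"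
  obtains y where "w = u @ y @ v" "f y \<noteq> 0"
proof -
  have "drop (length w - length v) w = v"
    using assms mult_word_nonsuffix by blast
  then obtain w' where w': "w = w' @ v" by (metis append_take_drop_id)
  with assms have *: "(word u \<otimes>\<^bsub>ncps X\<^esub> f) w' \<noteq> 0" by simp
  then have "take (length u) w' = u"
    using word_mult_nonprefix by blast
  then obtain y where "w' = u @ y" by (metis append_take_drop_id)
  with * w' show ?thesis using that[of y] by simp
qed

lemma shift_shift:
  assumes "f \<in> carrier (ncps X)" "u \<in> lists X" "v \<in> lists X" "a \<in> lists X" "b \<in> lists X"
  shows "shift X a (shift X u f v) b = shift X (a @ u) f (v @ b)"
  unfolding word_mult_word[symmetric, of a u X] word_mult_word[symmetric, of v b X]
  using assms by (simp add: ncps_mult_assoc)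

section \<open>The adic topology\<close>

text \<open>On the carrier this is congruence modulo the n-th power of the augmentation ideal when
  the alphabet is finite, see \<open>ideal_pow_aug_ideal\<close>. It replaces neighbourhoods in
  nearly all later arguments.\<close>

definition agree :: "nat \<Rightarrow> ('x list \<Rightarrow> 'k) \<Rightarrow> ('x list \<Rightarrow> 'k) \<Rightarrow> bool" where
  "agree n f g \<longleftrightarrow> (\<forall>w. length w < n \<longrightarrow> f w = g w)"

lemma agreeD: "agree n f g \<Longrightarrow> length w < n \<Longrightarrow> f w = g w"
  by (simp add: agree_def)

lemma agree_refl [simp]: "agree n f f"
  by (simp add: agree_def)

lemma agree_sym: "agree n f g \<Longrightarrow> agree n g f"
  by (simp add: agree_def)

lemma agree_trans: "agree n f g \<Longrightarrow> agree n g h \<Longrightarrow> agree n f h"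
  by (simp add: agree_def)

lemma agree_mono: "agree n f g \<Longrightarrow> m \<le> n \<Longrightarrow> agree m f g"
  by (auto simp: agree_def)

text \<open>The coefficient of a product at a word only involves coefficients of the factors at
  prefixes and suffixes of that word, which are no longer than it.\<close>

lemma agree_mult:
  assumes "agree n f f'" "agree n g g'"
  shows "agree n (f \<otimes>\<^bsub>ncps X\<^esub> g) (f' \<otimes>\<^bsub>ncps X\<^esub> g')"
  using assms by (auto simp: agree_def ncps_mult intro!: sum.cong)

text \<open>Finiteness of the alphabet enters from right to left: a series without terms of length
  at most n is the finite sum, over the letters x, of x times a series without terms of length less
  than n.\<close>

lemma ideal_pow_aug_ideal:
  fixes f :: "'x list \<Rightarrow> 'k :: {comm_ring, comm_monoid_mult}"
  assumes X: "finite X"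
  shows "f \<in> ideal_pow (ncps X) (aug_ideal X) n \<longleftrightarrow> f \<in> carrier (ncps X) \<and> agree n f (\<lambda>w. 0)"
proof (induction n arbitrary: f)
  case 0
  then show ?case by (simp add: agree_def)
next
  case (Suc n)
  let ?P = "ncps X :: ('k, 'x list \<Rightarrow> 'k) module"
  let ?I = "aug_ideal X :: ('x list \<Rightarrow> 'k) set"
  interpret ring ?P by (rule ring_ncps)
  have pow: "additive_subgroup (ideal_pow ?P ?I (Suc n)) ?P"
    by (rule ideal.axioms(1)[OF ideal_pow_is_ideal[OF ideal_aug_ideal]])
  have less: "f \<in> carrier ?P \<and> agree (Suc n) f (\<lambda>w. 0)" if "f \<in> ideal_prod ?P ?I (ideal_pow ?P ?I n)"
    using that
  proof induction
    case (prod i j)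
    then have j: "j \<in> carrier ?P" "agree n j (\<lambda>w. 0)" using Suc.IH by auto
    have i: "i \<in> carrier ?P" "i [] = 0" using prod(1) unfolding aug_ideal_def by blast+
    have "(i \<otimes>\<^bsub>?P\<^esub> j) w = 0" if "length w < Suc n" for w
    proof -
      \<comment> \<open>For k = 0 the factor \<open>i\<close> is evaluated at the empty word; for k
        > 0 the remaining suffix is shorter than n.\<close>
      have "i (take k w) * j (drop k w) = 0" if "k \<le> length w" for k
      proof (cases k)
        case (Suc l)
        then have "length (drop k w) < n" using that \<open>length w < Suc n\<close> by auto
        then show ?thesis using j by (simp add: agree_def)
      qed (use i in auto)
      then show ?thesis by (simp add: ncps_mult)
    qed
    then show ?case using ncps_mult_closed[OF i(1) j(1)] by (simp add: agree_def)
  next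
    case (sum s1 s2)
    then show ?case by (simp add: agree_def ncps_add_closed)
  qed
  have "f \<in> ideal_pow ?P ?I (Suc n)" if f: "f \<in> carrier ?P" "agree (Suc n) f (\<lambda>w. 0)"
  proof -
    \<comment> \<open>The part of f supported on words with first letter in Y is built up letter by
      letter; each new letter contributes one product of a generator of the ideal with an element of
      its n-th power.\<close>
    have "finite Y \<Longrightarrow> Y \<subseteq> X \<Longrightarrow>
        (\<lambda>w. if w \<noteq> [] \<and> hd w \<in> Y then f w else 0) \<in> ideal_pow ?P ?I (Suc n)" for Y
    proof (induction Y rule: finite_induct)
      case empty
      then show ?case using additive_subgroup.zero_closed[OF pow] by simp
    next
      case (insert x Y)
      define h where "h = (\<lambda>w. f (x # w))"
      have "h \<in> carrier ?P"
        using f(1) unfolding h_def ncps_carrier_iff by auto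
      moreover have "agree n h (\<lambda>w. 0)"
        using f(2) by (auto simp: agree_def h_def)
      ultimately have "h \<in> ideal_pow ?P ?I n" using Suc.IH by blast
      moreover have "word [x] \<in> ?I"
        unfolding aug_ideal_def using word_in_carrier[where w = "[x]" and X = X] insert.prems
        by (simp add: word_def)
      ultimately have "word [x] \<otimes>\<^bsub>?P\<^esub> h \<in> ideal_pow ?P ?I (Suc n)"
        by (auto intro: ideal_prod.prod)
      moreover have "(\<lambda>w. if w \<noteq> [] \<and> hd w \<in> Y then f w else 0) \<in> ideal_pow ?P ?I (Suc n)"
        using insert by blast
      ultimately have "(word [x] \<otimes>\<^bsub>?P\<^esub> h) \<oplus>\<^bsub>?P\<^esub> (\<lambda>w. if w \<noteq> [] \<and> hd w \<in> Y then f w else 0)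
          \<in> ideal_pow ?P ?I (Suc n)"
        by (rule additive_subgroup.a_closed[OF pow])
      also have "(word [x] \<otimes>\<^bsub>?P\<^esub> h) \<oplus>\<^bsub>?P\<^esub> (\<lambda>w. if w \<noteq> [] \<and> hd w \<in> Y then f w else 0) =
          (\<lambda>w. if w \<noteq> [] \<and> hd w \<in> insert x Y then f w else 0)"
      proof
        fix w
        show "((word [x] \<otimes>\<^bsub>?P\<^esub> h) \<oplus>\<^bsub>?P\<^esub> (\<lambda>w. if w \<noteq> [] \<and> hd w \<in> Y then f w else 0)) w =
          (if w \<noteq> [] \<and> hd w \<in> insert x Y then f w else 0)"
        proof (cases w)
          case Nil
          then show ?thesis by (simp add: word_mult_nonprefix)
        next
          case (Cons y v)
          then show ?thesis
            using word_mult[where u = "[x]" and X = X and f = h and w = v] insert.hyps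
              word_mult_nonprefix[where u = "[x]" and X = X and f = h and w = w]
            by (cases "x = y") (simp_all add: h_def)
        qed
      qed
      finally show ?case .
    qed
    from this[OF X order_refl]
    have "(\<lambda>w. if w \<noteq> [] \<and> hd w \<in> X then f w else 0) \<in> ideal_pow ?P ?I (Suc n)" .
    \<comment> \<open>Nothing is lost for Y = X: the coefficient of f at the empty word vanishes
      because 0 < n + 1.\<close>
    also have "(\<lambda>w. if w \<noteq> [] \<and> hd w \<in> X then f w else 0) = f"
    proof
      fix w show "(if w \<noteq> [] \<and> hd w \<in> X then f w else 0) = f w"
        using f by (cases w) (auto simp: agree_def ncps_carrier_iff)
    qed
    finally show ?thesis .
  qed
  with less show ?case unfolding ideal_pow.simps by blast
qed

lemma aug_ideal_coset:
  fixes f :: "'x list \<Rightarrow> 'k :: {comm_ring, comm_monoid_mult}"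
  assumes "finite X" "f \<in> carrier (ncps X)"
  shows "ideal_pow (ncps X) (aug_ideal X) n +>\<^bsub>ncps X\<^esub> f = {g \<in> carrier (ncps X). agree n g f}"
proof (intro equalityI subsetI)
  fix g assume "g \<in> {g \<in> carrier (ncps X). agree n g f}"
  then have "(\<lambda>w. g w - f w) \<in> ideal_pow (ncps X) (aug_ideal X) n"
    using assms by (auto simp: ideal_pow_aug_ideal agree_def)
  moreover have "g = (\<lambda>w. g w - f w) \<oplus>\<^bsub>ncps X\<^esub> f" by simp
  ultimately show "g \<in> ideal_pow (ncps X) (aug_ideal X) n +>\<^bsub>ncps X\<^esub> f"
    unfolding a_r_coset_def' by blast
qed (use assms in \<open>auto simp: a_r_coset_def' ideal_pow_aug_ideal agree_def\<close>)

lemma openin_ncps_topology: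
  fixes U :: "('x list \<Rightarrow> 'k :: {comm_ring, comm_monoid_mult}) set"
  assumes "finite X"
  shows "openin (ncps_topology X) U \<longleftrightarrow>
    U \<subseteq> carrier (ncps X) \<and> (\<forall>f\<in>U. \<exists>n. \<forall>g\<in>carrier (ncps X). agree n g f \<longrightarrow> g \<in> U)"
proof -
  let ?P = "ncps X :: ('k, 'x list \<Rightarrow> 'k) module"
  interpret ring ?P by (rule ring_ncps)
  have "openin (ncps_topology X) U \<longleftrightarrow> U \<subseteq> carrier ?P \<and>
      (\<forall>f\<in>U. \<exists>n. ideal_pow ?P (aug_ideal X) n +>\<^bsub>?P\<^esub> f \<subseteq> U)"
    unfolding ncps_topology_def by (rule openin_adic_topology[OF ideal_aug_ideal])
  also have "\<dots> \<longleftrightarrow> U \<subseteq> carrier (ncps X) \<and> (\<forall>f\<in>U. \<exists>n. \<forall>g\<in>carrier (ncps X). agree n g f \<longrightarrow> g \<in> U)"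
    using assms aug_ideal_coset by (intro conj_cong refl ball_cong) blast
  finally show ?thesis .
qed

lemma topspace_ncps_topology [simp]:
  assumes "finite X"
  shows "topspace (ncps_topology X) =
    carrier (ncps X :: ('k :: {comm_ring, comm_monoid_mult}, 'x list \<Rightarrow> 'k) module)"
proof
  show "topspace (ncps_topology X) \<subseteq>
      carrier (ncps X :: ('k :: {comm_ring, comm_monoid_mult}, 'x list \<Rightarrow> 'k) module)"
    using openin_ncps_topology[OF assms] openin_topspace by blast
  show "carrier (ncps X :: ('k :: {comm_ring, comm_monoid_mult}, 'x list \<Rightarrow> 'k) module) \<subseteq>
      topspace (ncps_topology X)"
    by (rule openin_subset) (auto simp: openin_ncps_topology[OF assms])
qed

lemma openin_agree:
  fixes f :: "'x list \<Rightarrow> 'k :: {comm_ring, comm_monoid_mult}"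
  assumes "finite X"
  shows "openin (ncps_topology X) {g \<in> carrier (ncps X). agree n g f}"
  unfolding openin_ncps_topology[OF assms]
proof (intro conjI ballI)
  fix h assume "h \<in> {g \<in> carrier (ncps X). agree n g f}"
  then show "\<exists>m. \<forall>g\<in>carrier (ncps X). agree m g h \<longrightarrow> g \<in> {g \<in> carrier (ncps X). agree n g f}"
    by (intro exI[of _ n]) (blast intro: agree_trans)
qed blast

lemma ncps_closure_of:
  fixes I :: "('x list \<Rightarrow> 'k :: {comm_ring, comm_monoid_mult}) set"
  assumes "finite X" "I \<subseteq> carrier (ncps X)"
  shows "ncps_topology X closure_of I = {f \<in> carrier (ncps X). \<forall>n. \<exists>g\<in>I. agree n f g}"
proof (intro equalityI subsetI)
  fix f assume f: "f \<in> ncps_topology X closure_of I"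
  then have fc: "f \<in> carrier (ncps X)" using assms by (simp add: in_closure_of)
  have "\<exists>g\<in>I. agree n f g" for n
  proof -
    have "f \<in> {g \<in> carrier (ncps X). agree n g f}" using fc by simp
    then have "\<exists>y. y \<in> I \<and> y \<in> {g \<in> carrier (ncps X). agree n g f}"
      using f openin_agree[OF assms(1), of n f] unfolding in_closure_of by meson
    then show ?thesis using agree_sym by blast
  qed
  with fc show "f \<in> {f \<in> carrier (ncps X). \<forall>n. \<exists>g\<in>I. agree n f g}" by blast
next
  fix f assume f: "f \<in> {f \<in> carrier (ncps X). \<forall>n. \<exists>g\<in>I. agree n f g}"
  show "f \<in> ncps_topology X closure_of I"
    unfolding in_closure_of
  proof (intro conjI allI impI)
    fix T assume "f \<in> T \<and> openin (ncps_topology X) T"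
    then obtain n where "\<forall>g\<in>carrier (ncps X). agree n g f \<longrightarrow> g \<in> T"
      unfolding openin_ncps_topology[OF assms(1)] by blast
    then show "\<exists>y. y \<in> I \<and> y \<in> T" using f assms(2) agree_sym by blast
  next
    show "f \<in> topspace (ncps_topology X)"
      using f unfolding topspace_ncps_topology[OF assms(1)] by blast
  qed
qed

text \<open>The sets of series agreeing with f up to length n suffice as neighbourhoods of f, and
  finite sums in the ring are computed coefficientwise. Summability becomes a statement about
  finitely many coefficients at a time.\<close>

lemma has_topological_sum_ncps:
  fixes b :: "'i \<Rightarrow> 'x list \<Rightarrow> 'k :: {comm_ring, comm_monoid_mult}"
  assumes X: "finite X" and b: "b \<in> N \<rightarrow> carrier (ncps X)"
  shows "has_topological_sum (ncps X) (ncps_topology X) b N f \<longleftrightarrow>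
    f \<in> carrier (ncps X) \<and> (\<forall>n. \<exists>F. finite F \<and> F \<subseteq> N \<and>
      (\<forall>F'. finite F' \<and> F \<subseteq> F' \<and> F' \<subseteq> N \<longrightarrow> agree n (\<lambda>w. \<Sum>i\<in>F'. b i w) f))"
    (is "?L \<longleftrightarrow> ?R")
proof
  assume L: ?L
  then have f: "f \<in> carrier (ncps X)" using X by (simp add: has_topological_sum_iff)
  have "\<exists>F. finite F \<and> F \<subseteq> N \<and>
      (\<forall>F'. finite F' \<and> F \<subseteq> F' \<and> F' \<subseteq> N \<longrightarrow> agree n (\<lambda>w. \<Sum>i\<in>F'. b i w) f)" for n
  proof -
    let ?U = "{g \<in> carrier (ncps X). agree n g f}"
    have "openin (ncps_topology X) ?U \<and> f \<in> ?U" using openin_agree[OF X] f by simp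
    then obtain F where F: "finite F" "F \<subseteq> N"
      "\<forall>F'. finite F' \<and> F \<subseteq> F' \<and> F' \<subseteq> N \<longrightarrow> finsum (ncps X) b F' \<in> ?U"
      using L unfolding has_topological_sum_iff by blast
    have "agree n (\<lambda>w. \<Sum>i\<in>F'. b i w) f" if "finite F' \<and> F \<subseteq> F' \<and> F' \<subseteq> N" for F'
    proof -
      have "b \<in> F' \<rightarrow> carrier (ncps X)" using b that by blast
      then show ?thesis using F(3)[rule_format, OF that] that by (simp add: ncps_finsum)
    qed
    with F show ?thesis by blast
  qed
  with f show ?R by blast
next
  assume R: ?R
  show ?L
    unfolding has_topological_sum_iff
  proof (intro conjI allI impI)
    fix U assume "openin (ncps_topology X) U \<and> f \<in> U"
    then obtain n where n: "\<forall>g\<in>carrier (ncps X). agree n g f \<longrightarrow> g \<in> U"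
      unfolding openin_ncps_topology[OF X] by blast
    obtain F where F: "finite F" "F \<subseteq> N"
      "\<And>F'. finite F' \<and> F \<subseteq> F' \<and> F' \<subseteq> N \<longrightarrow> agree n (\<lambda>w. \<Sum>i\<in>F'. b i w) f"
      using R by blast
    have "finsum (ncps X) b F' \<in> U" if F': "finite F' \<and> F \<subseteq> F' \<and> F' \<subseteq> N" for F'
    proof -
      have b': "b \<in> F' \<rightarrow> carrier (ncps X)" using b that by blast
      have "finsum (ncps X) b F' = (\<lambda>w. \<Sum>i\<in>F'. b i w)"
        by (rule ncps_finsum) (use F' b' in auto)
      moreover have "(\<lambda>w. \<Sum>i\<in>F'. b i w) \<in> carrier (ncps X)"
        using b' by (intro ncps_sum_closed) blast
      ultimately show ?thesis using F(3) F' n by simp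
    qed
    then show "\<exists>F. finite F \<and> F \<subseteq> N \<and>
        (\<forall>F'. finite F' \<and> F \<subseteq> F' \<and> F' \<subseteq> N \<longrightarrow> finsum (ncps X) b F' \<in> U)"
      using F by blast
  next
    show "f \<in> topspace (ncps_topology X)"
      using R unfolding topspace_ncps_topology[OF X] by blast
  qed
qed

lemma finite_short_words:
  assumes "finite X"
  shows "finite {w \<in> lists X. length w < n}"
  by (rule finite_subset[OF _ finite_lists_length_le[OF assms, of n]]) auto

text \<open>Density of the linear combinations of words; it reduces multiplication by a series to
  multiplication by words.\<close>

lemma agree_expansion:
  assumes "finite X" "f \<in> carrier (ncps X)"
  shows "agree n f (\<lambda>w. \<Sum>v\<in>{v \<in> lists X. length v < n}. f v * word v w)"
  unfolding agree_def
proof (intro allI impI)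
  fix w :: "'a list" assume w: "length w < n"
  let ?A = "{v \<in> lists X. length v < n}"
  have "(\<Sum>v\<in>?A. f v * word v w) = (\<Sum>v\<in>?A. if v = w then f w else 0)"
    by (rule sum.cong) (auto simp: word_def)
  also have "\<dots> = f w"
    using finite_short_words[OF assms(1), of n] w assms(2)
    by (auto simp: sum.delta ncps_carrier_iff)
  finally show "f w = (\<Sum>v\<in>?A. f v * word v w)" by simp
qed

lemma ncps_idealI:
  fixes I :: "('x list \<Rightarrow> 'k :: {comm_ring, comm_monoid_mult}) set"
  assumes "I \<subseteq> carrier (ncps X)" "(\<lambda>w. 0) \<in> I"
    and "\<And>f g. f \<in> I \<Longrightarrow> g \<in> I \<Longrightarrow> (\<lambda>w. f w + g w) \<in> I"
    and "\<And>f. f \<in> I \<Longrightarrow> (\<lambda>w. - f w) \<in> I"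
    and "\<And>f g. f \<in> I \<Longrightarrow> g \<in> carrier (ncps X) \<Longrightarrow> g \<otimes>\<^bsub>ncps X\<^esub> f \<in> I"
    and "\<And>f g. f \<in> I \<Longrightarrow> g \<in> carrier (ncps X) \<Longrightarrow> f \<otimes>\<^bsub>ncps X\<^esub> g \<in> I"
  shows "ideal I (ncps X)"
proof (rule idealI)
  show "subgroup I (add_monoid (ncps X))"
  proof
    fix f assume f: "f \<in> I"
    then have "\<ominus>\<^bsub>ncps X\<^esub> f = (\<lambda>w. - f w)" using assms(1) by (intro ncps_uminus) auto
    then show "inv\<^bsub>add_monoid (ncps X)\<^esub> f \<in> I"
      using assms(4)[OF f] by (simp add: a_inv_def)
  qed (use assms(1-3) in auto)
qed (use assms ring_ncps in auto)

section \<open>Closed linear spans\<close>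

text \<open>The step adds one scalar multiple of a generator, so inductions over the span treat a
  single generator at a time. Only scalars act here; products with words are put into the generating
  set.\<close>

inductive_set lin_span :: "('x list \<Rightarrow> 'k :: {comm_ring, comm_monoid_mult}) set \<Rightarrow> ('x list \<Rightarrow> 'k) set"
  for G where
  zero: "(\<lambda>w. 0) \<in> lin_span G"
| step: "l \<in> lin_span G \<Longrightarrow> g \<in> G \<Longrightarrow> (\<lambda>w. l w + a * g w) \<in> lin_span G"

lemma lin_span_add:
  assumes "l \<in> lin_span G" "k \<in> lin_span G"
  shows "(\<lambda>w. l w + k w) \<in> lin_span G"
  using assms(2)
proof induction
  case (step k g a)
  then show ?case using lin_span.step[of "\<lambda>w. l w + k w" G g a] by (simp add: add.assoc)
qed (simp add: assms(1))

lemma lin_span_smult: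
  assumes "l \<in> lin_span G"
  shows "(\<lambda>w. c * l w) \<in> lin_span G"
  using assms
proof induction
  case (step l g a)
  then show ?case using lin_span.step[of "\<lambda>w. c * l w" G g "c * a"] by (simp add: algebra_simps)
qed (simp add: lin_span.zero)

text \<open>The adic closure of the linear span, within the ring. Its elements come with
  approximations only, not with a representation as a topological sum, which makes stability under
  limits immediate.\<close>

definition closed_span ::
    "'x set \<Rightarrow> ('x list \<Rightarrow> 'k :: {comm_ring, comm_monoid_mult}) set \<Rightarrow> ('x list \<Rightarrow> 'k) set" where
  "closed_span X G = {f \<in> carrier (ncps X). \<forall>n. \<exists>l\<in>lin_span G. agree n f l}"

lemma closed_span_carrier: "f \<in> closed_span X G \<Longrightarrow> f \<in> carrier (ncps X)"
  by (simp add: closed_span_def)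

lemma closed_span_approx:
  assumes "f \<in> closed_span X G"
  obtains l where "l \<in> lin_span G" "agree n f l"
  using assms by (auto simp: closed_span_def)

lemma closed_span_base: "g \<in> G \<Longrightarrow> g \<in> carrier (ncps X) \<Longrightarrow> g \<in> closed_span X G"
  using lin_span.step[OF lin_span.zero, of g G 1]
  by (auto simp: closed_span_def intro: agree_refl)

lemma closed_span_zero: "(\<lambda>w. 0) \<in> closed_span X G"
  by (auto simp: closed_span_def intro: lin_span.zero agree_refl)

lemma closed_span_add:
  assumes "f \<in> closed_span X G" "g \<in> closed_span X G"
  shows "(\<lambda>w. f w + g w) \<in> closed_span X G"
  unfolding closed_span_def mem_Collect_eq
proof (intro conjI allI)
  fix n
  obtain l k where "l \<in> lin_span G" "agree n f l" "k \<in> lin_span G" "agree n g k"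
    using assms closed_span_approx by metis
  then show "\<exists>l\<in>lin_span G. agree n (\<lambda>w. f w + g w) l"
    using lin_span_add by (intro bexI[of _ "\<lambda>w. l w + k w"]) (auto simp: agree_def)
qed (intro ncps_add_closed; rule closed_span_carrier[OF assms(1)] closed_span_carrier[OF assms(2)])

lemma closed_span_smult:
  assumes "f \<in> closed_span X G"
  shows "(\<lambda>w. a * f w) \<in> closed_span X G"
  unfolding closed_span_def mem_Collect_eq
proof (intro conjI allI)
  fix n
  obtain l where "l \<in> lin_span G" "agree n f l"
    using assms closed_span_approx by metis
  then show "\<exists>l\<in>lin_span G. agree n (\<lambda>w. a * f w) l"
    using lin_span_smult by (intro bexI[of _ "\<lambda>w. a * l w"]) (auto simp: agree_def)
qed (intro ncps_smult_closed closed_span_carrier[OF assms])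

lemma closed_span_uminus:
  assumes "f \<in> closed_span X G"
  shows "(\<lambda>w. - f w) \<in> closed_span X G"
  using closed_span_smult[OF assms, of "- 1"] by simp

lemma closed_span_diff:
  assumes "f \<in> closed_span X G" "g \<in> closed_span X G"
  shows "(\<lambda>w. f w - g w) \<in> closed_span X G"
  using closed_span_add[OF assms(1) closed_span_uminus[OF assms(2)]] by simp

lemma closed_span_sum:
  "(\<And>i. i \<in> F \<Longrightarrow> b i \<in> closed_span X G) \<Longrightarrow> (\<lambda>w. \<Sum>i\<in>F. b i w) \<in> closed_span X G"
  by (induction F rule: infinite_finite_induct) (auto intro: closed_span_add closed_span_zero)

lemma closed_span_limit:
  assumes "f \<in> carrier (ncps X)" "\<And>n. \<exists>g\<in>closed_span X G. agree n f g"
  shows "f \<in> closed_span X G"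
  using assms by (simp add: closed_span_def) (metis agree_trans)

lemma lin_span_mono: "G \<subseteq> H \<Longrightarrow> lin_span G \<subseteq> lin_span H"
proof
  fix l assume "l \<in> lin_span G" "G \<subseteq> H"
  then show "l \<in> lin_span H" by induction (auto intro: lin_span.intros)
qed

lemma closed_span_mono: "G \<subseteq> H \<Longrightarrow> closed_span X G \<subseteq> closed_span X H"
  using lin_span_mono[of G H] unfolding closed_span_def by blast

text \<open>A continuous linear map sends a closed span into any closed span that contains the
  images of the generators. Linearity is stated in the shape of the rule
  \<open>lin_span.step\<close>, and continuity as preservation of \<open>agree n\<close>.\<close>

lemma closed_span_map:
  assumes "f \<in> closed_span X G" "T f \<in> carrier (ncps X)"
    and zero: "T (\<lambda>w. 0) = (\<lambda>w. 0)"
    and lin: "\<And>l g a. T (\<lambda>w. l w + a * g w) = (\<lambda>w. T l w + a * T g w)"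
    and cont: "\<And>n f g. agree n f g \<Longrightarrow> agree n (T f) (T g)"
    and gen: "\<And>g. g \<in> G \<Longrightarrow> T g \<in> closed_span X H"
  shows "T f \<in> closed_span X H"
proof (rule closed_span_limit)
  fix n
  obtain l where l: "l \<in> lin_span G" "agree n f l" using assms(1) closed_span_approx by metis
  from l(1) have "T l \<in> closed_span X H"
  proof induction
    case (step l g a)
    then show ?case
      unfolding lin using closed_span_add[OF _ closed_span_smult[OF gen]] by blast
  qed (simp add: zero closed_span_zero)
  then show "\<exists>g\<in>closed_span X H. agree n (T f) g" using cont[OF l(2)] by blast
qed fact

text \<open>Modulo every power of the augmentation ideal, g is a finite combination of words. The
  condition on generators is confined to words in the support of g, so that lower bounds on leading
  words can be carried through the product.\<close>

lemma closed_span_mult_left: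
  assumes X: "finite X" and f: "f \<in> closed_span X G" and g: "g \<in> carrier (ncps X)"
    and G: "G \<subseteq> carrier (ncps X)"
    and gen: "\<And>u q. g u \<noteq> 0 \<Longrightarrow> q \<in> G \<Longrightarrow> word u \<otimes>\<^bsub>ncps X\<^esub> q \<in> closed_span X H"
  shows "g \<otimes>\<^bsub>ncps X\<^esub> f \<in> closed_span X H"
proof (rule closed_span_map[OF f])
  fix q assume q: "q \<in> G"
  show "g \<otimes>\<^bsub>ncps X\<^esub> q \<in> closed_span X H"
  proof (rule closed_span_limit)
    show "g \<otimes>\<^bsub>ncps X\<^esub> q \<in> carrier (ncps X)" using g G q by (intro ncps_mult_closed) auto
    fix n
    let ?A = "{v \<in> lists X. length v < n}"
    have "agree n (g \<otimes>\<^bsub>ncps X\<^esub> q) ((\<lambda>w. \<Sum>v\<in>?A. g v * word v w) \<otimes>\<^bsub>ncps X\<^esub> q)"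
      by (intro agree_mult agree_expansion X g agree_refl)
    moreover have "(\<lambda>w. \<Sum>v\<in>?A. g v * word v w) \<otimes>\<^bsub>ncps X\<^esub> q =
        (\<lambda>w. \<Sum>v\<in>?A. g v * (word v \<otimes>\<^bsub>ncps X\<^esub> q) w)"
      by (simp add: ncps_sum_mult ncps_mult_bilinear)
    \<comment> \<open>Outside the support of g nothing is known about the product with v, but there
      the scalar is zero.\<close>
    moreover have "(\<lambda>w. g v * (word v \<otimes>\<^bsub>ncps X\<^esub> q) w) \<in> closed_span X H" for v
      using gen[OF _ q, of v] closed_span_zero[of X H]
      by (cases "g v = 0") (simp_all add: closed_span_smult)
    then have "(\<lambda>w. \<Sum>v\<in>?A. g v * (word v \<otimes>\<^bsub>ncps X\<^esub> q) w) \<in> closed_span X H"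
      by (intro closed_span_sum)
    ultimately show "\<exists>h\<in>closed_span X H. agree n (g \<otimes>\<^bsub>ncps X\<^esub> q) h" by auto
  qed
qed (auto simp: ncps_mult_bilinear agree_mult intro!: ncps_mult_closed g closed_span_carrier[OF f])

lemma closed_span_mult_right:
  assumes X: "finite X" and f: "f \<in> closed_span X G" and g: "g \<in> carrier (ncps X)"
    and G: "G \<subseteq> carrier (ncps X)"
    and gen: "\<And>u q. g u \<noteq> 0 \<Longrightarrow> q \<in> G \<Longrightarrow> q \<otimes>\<^bsub>ncps X\<^esub> word u \<in> closed_span X H"
  shows "f \<otimes>\<^bsub>ncps X\<^esub> g \<in> closed_span X H"
proof (rule closed_span_map[OF f, where T = "\<lambda>f. f \<otimes>\<^bsub>ncps X\<^esub> g"])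
  fix q assume q: "q \<in> G"
  show "q \<otimes>\<^bsub>ncps X\<^esub> g \<in> closed_span X H"
  proof (rule closed_span_limit)
    show "q \<otimes>\<^bsub>ncps X\<^esub> g \<in> carrier (ncps X)" using g G q by (intro ncps_mult_closed) auto
    fix n
    let ?A = "{v \<in> lists X. length v < n}"
    have "agree n (q \<otimes>\<^bsub>ncps X\<^esub> g) (q \<otimes>\<^bsub>ncps X\<^esub> (\<lambda>w. \<Sum>v\<in>?A. g v * word v w))"
      by (intro agree_mult agree_expansion X g agree_refl)
    moreover have "q \<otimes>\<^bsub>ncps X\<^esub> (\<lambda>w. \<Sum>v\<in>?A. g v * word v w) =
        (\<lambda>w. \<Sum>v\<in>?A. g v * (q \<otimes>\<^bsub>ncps X\<^esub> word v) w)"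
      by (simp add: ncps_sum_mult ncps_mult_bilinear)
    moreover have "(\<lambda>w. g v * (q \<otimes>\<^bsub>ncps X\<^esub> word v) w) \<in> closed_span X H" for v
      using gen[OF _ q, of v] closed_span_zero[of X H]
      by (cases "g v = 0") (simp_all add: closed_span_smult)
    then have "(\<lambda>w. \<Sum>v\<in>?A. g v * (q \<otimes>\<^bsub>ncps X\<^esub> word v) w) \<in> closed_span X H"
      by (intro closed_span_sum)
    ultimately show "\<exists>h\<in>closed_span X H. agree n (q \<otimes>\<^bsub>ncps X\<^esub> g) h" by auto
  qed
qed (auto simp: ncps_mult_bilinear agree_mult intro!: ncps_mult_closed g closed_span_carrier[OF f])

section \<open>Closed ideals\<close>

lemma closed_ideal_iff:
  fixes S :: "('x list \<Rightarrow> 'k :: {comm_ring, comm_monoid_mult}) set"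
  assumes "finite X" "S \<subseteq> carrier (ncps X)"
  shows "f \<in> closed_ideal X S \<longleftrightarrow>
    f \<in> carrier (ncps X) \<and> (\<forall>n. \<exists>g\<in>genideal (ncps X) S. agree n f g)"
proof -
  interpret ring "ncps X :: ('k, 'x list \<Rightarrow> 'k) module" by (rule ring_ncps)
  have "genideal (ncps X) S \<subseteq> carrier (ncps X)"
    by (rule additive_subgroup.a_subset[OF ideal.axioms(1)[OF genideal_ideal[OF assms(2)]]])
  then show ?thesis unfolding closed_ideal_def by (simp add: ncps_closure_of assms(1))
qed

lemma closed_ideal_limit:
  fixes S :: "('x list \<Rightarrow> 'k :: {comm_ring, comm_monoid_mult}) set"
  assumes "finite X" "S \<subseteq> carrier (ncps X)" "f \<in> carrier (ncps X)"
    and "\<And>n. \<exists>g\<in>closed_ideal X S. agree n f g"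
  shows "f \<in> closed_ideal X S"
  unfolding closed_ideal_iff[OF assms(1,2)]
proof (intro conjI allI)
  fix n
  obtain g where g: "g \<in> closed_ideal X S" "agree n f g" using assms(4) by blast
  then obtain h where "h \<in> genideal (ncps X) S" "agree n g h"
    unfolding closed_ideal_iff[OF assms(1,2)] by blast
  with g show "\<exists>g\<in>genideal (ncps X) S. agree n f g" using agree_trans by blast
qed fact

text \<open>Sums, negatives and products respect \<open>agree n\<close>, so approximations by
  elements of the generated ideal can be combined in the same way as the elements
  themselves.\<close>

lemma ideal_closed_ideal:
  fixes S :: "('x list \<Rightarrow> 'k :: {comm_ring, comm_monoid_mult}) set"
  assumes "finite X" "S \<subseteq> carrier (ncps X)"
  shows "ideal (closed_ideal X S) (ncps X)"
proof -
  let ?I = "genideal (ncps X) S"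
  note iff = closed_ideal_iff[OF assms]
  interpret ring "ncps X :: ('k, 'x list \<Rightarrow> 'k) module" by (rule ring_ncps)
  interpret I: ideal ?I "ncps X" by (rule genideal_ideal[OF assms(2)])
  show ?thesis
  proof (rule ncps_idealI)
    fix f g assume "f \<in> closed_ideal X S" "g \<in> closed_ideal X S"
    then have f: "f \<in> carrier (ncps X)" "\<And>n. \<exists>h\<in>?I. agree n f h"
      and g: "g \<in> carrier (ncps X)" "\<And>n. \<exists>h\<in>?I. agree n g h"
      unfolding iff by blast+
    have "\<exists>h\<in>?I. agree n (\<lambda>w. f w + g w) h" for n
    proof -
      obtain h k where "h \<in> ?I" "agree n f h" "k \<in> ?I" "agree n g k" using f g by blast
      then show ?thesis using I.a_closed[of h k]
        by (intro bexI[of _ "\<lambda>w. h w + k w"]) (simp_all add: agree_def)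
    qed
    with f g show "(\<lambda>w. f w + g w) \<in> closed_ideal X S" by (simp add: iff ncps_add_closed)
  next
    fix f assume "f \<in> closed_ideal X S"
    then have f: "f \<in> carrier (ncps X)" "\<And>n. \<exists>h\<in>?I. agree n f h" by (auto simp: iff)
    have "\<exists>h\<in>?I. agree n (\<lambda>w. - f w) h" for n
    proof -
      obtain h where "h \<in> ?I" "agree n f h" using f by blast
      then show ?thesis using I.a_inv_closed[of h] ncps_uminus[OF I.Icarr]
        by (intro bexI[of _ "\<lambda>w. - h w"]) (simp_all add: agree_def)
    qed
    with f show "(\<lambda>w. - f w) \<in> closed_ideal X S" by (simp add: iff ncps_uminus_closed)
  next
    fix f g :: "'x list \<Rightarrow> 'k" assume "f \<in> closed_ideal X S" and g: "g \<in> carrier (ncps X)"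
    then have f: "f \<in> carrier (ncps X)" "\<And>n. \<exists>h\<in>?I. agree n f h" by (auto simp: iff)
    have "\<exists>h\<in>?I. agree n (g \<otimes>\<^bsub>ncps X\<^esub> f) h" "\<exists>h\<in>?I. agree n (f \<otimes>\<^bsub>ncps X\<^esub> g) h" for n
    proof -
      obtain h where h: "h \<in> ?I" "agree n f h" using f by blast
      show "\<exists>h\<in>?I. agree n (g \<otimes>\<^bsub>ncps X\<^esub> f) h"
        using I.I_l_closed[OF h(1) g] agree_mult[OF agree_refl h(2)] by blast
      show "\<exists>h\<in>?I. agree n (f \<otimes>\<^bsub>ncps X\<^esub> g) h"
        using I.I_r_closed[OF h(1) g] agree_mult[OF h(2) agree_refl] by blast
    qed
    with f g show "g \<otimes>\<^bsub>ncps X\<^esub> f \<in> closed_ideal X S" "f \<otimes>\<^bsub>ncps X\<^esub> g \<in> closed_ideal X S"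
      unfolding iff by (blast intro: ncps_mult_closed)+
  next
    show "(\<lambda>w. 0) \<in> closed_ideal X S"
      unfolding iff using I.zero_closed agree_refl unfolding ncps_simps by blast
  qed (auto simp: iff)
qed

lemma subset_closed_ideal:
  fixes S :: "('x list \<Rightarrow> 'k :: {comm_ring, comm_monoid_mult}) set"
  assumes "finite X" "S \<subseteq> carrier (ncps X)"
  shows "S \<subseteq> closed_ideal X S"
proof -
  interpret ring "ncps X :: ('k, 'x list \<Rightarrow> 'k) module" by (rule ring_ncps)
  show ?thesis
  proof
    fix s assume s: "s \<in> S"
    then have "s \<in> genideal (ncps X) S" using genideal_self[OF assms(2)] by blast
    then show "s \<in> closed_ideal X S"
      using s assms(2) unfolding closed_ideal_iff[OF assms] by (meson agree_refl subsetD)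
  qed
qed

section \<open>Monomial orders and leading words\<close>

locale monomial_order =
  fixes X :: "'x set" and r :: "'x list rel"
  assumes finite_alphabet: "finite X"
    and admissible: "admissible_order X r"
    and N_order: "N_order_on (lists X) r"
begin

lemma order_subset: "r \<subseteq> lists X \<times> lists X"
  and order_refl: "w \<in> lists X \<Longrightarrow> (w, w) \<in> r"
  and order_trans: "(u, v) \<in> r \<Longrightarrow> (v, w) \<in> r \<Longrightarrow> (u, w) \<in> r"
  and order_antisym: "(u, v) \<in> r \<Longrightarrow> (v, u) \<in> r \<Longrightarrow> u = v"
  and order_total: "u \<in> lists X \<Longrightarrow> v \<in> lists X \<Longrightarrow> (u, v) \<in> r \<or> (v, u) \<in> r"
proof -
  have r: "r \<subseteq> lists X \<times> lists X" "refl_on (lists X) r" "trans r" "antisym r" "total_on (lists X) r"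
    using admissible by (auto simp: admissible_order_def order_on_defs)
  show "r \<subseteq> lists X \<times> lists X" by fact
  show refl: "w \<in> lists X \<Longrightarrow> (w, w) \<in> r" for w using r(2) by (simp add: refl_on_def)
  show "(u, v) \<in> r \<Longrightarrow> (v, w) \<in> r \<Longrightarrow> (u, w) \<in> r" using r(3) by (meson transE)
  show "(u, v) \<in> r \<Longrightarrow> (v, u) \<in> r \<Longrightarrow> u = v" using r(4) by (meson antisymD)
  show "u \<in> lists X \<Longrightarrow> v \<in> lists X \<Longrightarrow> (u, v) \<in> r \<or> (v, u) \<in> r"
    using r(5) refl[of u] unfolding total_on_def by metis
qed

definition less :: "'x list \<Rightarrow> 'x list \<Rightarrow> bool" where
  "less u v \<longleftrightarrow> (u, v) \<in> r - Id"

lemma less_iff: "less u v \<longleftrightarrow> (u, v) \<in> r \<and> u \<noteq> v"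
  by (auto simp: less_def)

lemma less_words: "less u v \<Longrightarrow> u \<in> lists X" "less u v \<Longrightarrow> v \<in> lists X"
  using order_subset by (auto simp: less_iff)

lemma less_le_trans: "less u v \<Longrightarrow> (v, w) \<in> r \<Longrightarrow> less u w"
  unfolding less_iff using order_trans order_antisym by blast

lemma not_less: "u \<in> lists X \<Longrightarrow> v \<in> lists X \<Longrightarrow> \<not> less u v \<longleftrightarrow> (v, u) \<in> r"
  using order_total[of u v] order_antisym[of u v] order_refl by (auto simp: less_iff)

lemma less_mono:
  "less u v \<Longrightarrow> a \<in> lists X \<Longrightarrow> b \<in> lists X \<Longrightarrow> less (a @ u @ b) (a @ v @ b)"
  using admissible less_words[of u v] unfolding admissible_order_def less_def by blast

lemma le_mono:
  assumes "(u, v) \<in> r" "a \<in> lists X" "b \<in> lists X"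
  shows "(a @ u @ b, a @ v @ b) \<in> r"
proof (cases "u = v")
  case True
  then have "a @ u @ b \<in> lists X" using assms order_subset by auto
  with True show ?thesis using order_refl by simp
next
  case False
  then show ?thesis using less_mono[of u v a b] assms by (simp add: less_iff)
qed

lemma le_append:
  assumes "(u, v) \<in> r" "(u', v') \<in> r"
  shows "(u @ u', v @ v') \<in> r"
proof -
  have w: "u \<in> lists X" "v' \<in> lists X" "v \<in> lists X" "u' \<in> lists X" using assms order_subset by auto
  have "(u @ u' @ [], u @ v' @ []) \<in> r" "([] @ u @ v', [] @ v @ v') \<in> r"
    using le_mono[OF assms(2) w(1), of "[]"] le_mono[OF assms(1), of "[]" v'] w(2)
    by (simp_all only: lists.Nil)
  then show ?thesis using order_trans by simp
qed

lemma finite_below: "finite {v. (v, w) \<in> r}"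
proof (cases "w \<in> lists X")
  case True
  moreover have "{v. (v, w) \<in> r} \<subseteq> lists X" using order_subset by blast
  ultimately show ?thesis using N_order unfolding N_order_on_def by blast
next
  case False
  then have "{v. (v, w) \<in> r} = {}" using order_subset by auto
  then show ?thesis by simp
qed

text \<open>The number of words below w is a natural number by the N-order property and serves as a
  rank. It yields well-foundedness, and being injective on words it later numbers the terms of a sum
  by natural numbers.\<close>

lemma card_below_less:
  assumes "less u v"
  shows "card {w. (w, u) \<in> r} < card {w. (w, v) \<in> r}"
proof (rule psubset_card_mono[OF finite_below])
  have "v \<in> {w. (w, v) \<in> r}" "v \<notin> {w. (w, u) \<in> r}"
    using assms less_words[OF assms] order_refl order_antisym by (auto simp: less_iff)
  moreover have "{w. (w, u) \<in> r} \<subseteq> {w. (w, v) \<in> r}"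
    using assms order_trans by (auto simp: less_iff)
  ultimately show "{w. (w, u) \<in> r} \<subset> {w. (w, v) \<in> r}" by blast
qed

lemma wf_less: "wf {(u, v). less u v}"
  by (rule wf_subset[OF wf_measure[of "\<lambda>w. card {v. (v, w) \<in> r}"]]) (auto simp: card_below_less)

lemma least_word:
  assumes "A \<subseteq> lists X" "A \<noteq> {}"
  obtains w where "w \<in> A" "\<And>v. v \<in> A \<Longrightarrow> (w, v) \<in> r"
proof -
  obtain w where w: "w \<in> A" "\<And>v. less v w \<Longrightarrow> v \<notin> A"
    using wf_less assms(2) unfolding wf_eq_minimal by (metis (no_types, lifting) all_not_in_conv case_prodI mem_Collect_eq)
  have "(w, v) \<in> r" if "v \<in> A" for v
    using w that assms(1) not_less[of v w] by blast
  then show ?thesis using that w by blast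
qed

text \<open>Applied to the words below a given one, this provides an immediate predecessor.\<close>

lemma greatest_word:
  assumes "finite A" "A \<noteq> {}" "A \<subseteq> lists X"
  obtains w where "w \<in> A" "\<And>v. v \<in> A \<Longrightarrow> (v, w) \<in> r"
proof -
  have "\<exists>w\<in>A. \<forall>v\<in>A. (v, w) \<in> r"
    using assms
  proof (induction rule: finite_ne_induct)
    case (singleton x)
    then show ?case using order_refl by auto
  next
    case (insert x A)
    then obtain w where w: "w \<in> A" "\<forall>v\<in>A. (v, w) \<in> r" by auto
    have xw: "x \<in> lists X" "w \<in> lists X" using insert.prems w by auto
    show ?case
    proof (cases "(x, w) \<in> r")
      case True
      then show ?thesis using w by blast
    next
      case False
      then have "(w, x) \<in> r" using order_total xw by blast
      then have "\<forall>v\<in>insert x A. (v, x) \<in> r" using w order_trans order_refl[OF xw(1)] by blast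
      then show ?thesis by blast
    qed
  qed
  then show ?thesis using that by blast
qed

lemma mt_eqI:
  assumes "f w \<noteq> 0" "\<And>v. f v \<noteq> 0 \<Longrightarrow> (w, v) \<in> r"
  shows "mt r f = w"
  unfolding mt_def by (rule the_equality) (use assms order_antisym in blast)+

lemma mt_props:
  assumes "f \<in> carrier (ncps X)" "f \<noteq> (\<lambda>w. 0)"
  shows mt_nonzero: "f (mt r f) \<noteq> 0" and mt_le: "f v \<noteq> 0 \<Longrightarrow> (mt r f, v) \<in> r"
    and mt_word: "mt r f \<in> lists X"
proof -
  have sub: "{w. f w \<noteq> 0} \<subseteq> lists X" using assms(1) ncps_carrierD by blast
  obtain w where w: "w \<in> {w. f w \<noteq> 0}" "\<And>v. v \<in> {w. f w \<noteq> 0} \<Longrightarrow> (w, v) \<in> r"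
    using least_word[OF sub] assms(2) by blast
  then have "mt r f = w" by (intro mt_eqI) auto
  with w sub show "f (mt r f) \<noteq> 0" "f v \<noteq> 0 \<Longrightarrow> (mt r f, v) \<in> r" "mt r f \<in> lists X" by auto
qed

text \<open>The link between order and topology: a series with leading word w has terms of length
  less than n only if w lies in this set. Hence series with distinct leading words form a summable
  family.\<close>

lemma finite_le_short: "finite {w. \<exists>v. length v < n \<and> (w, v) \<in> r}"
proof (rule finite_subset)
  show "{w. \<exists>v. length v < n \<and> (w, v) \<in> r} \<subseteq>
      (\<Union>v\<in>{v \<in> lists X. length v < n}. {w. (w, v) \<in> r})"
    using order_subset by blast
  show "finite (\<Union>v\<in>{v \<in> lists X. length v < n}. {w. (w, v) \<in> r})"
    using finite_short_words[OF finite_alphabet] finite_below by blast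
qed

end

section \<open>Monic sets and the closed spans of their word multiples\<close>

locale monic_set = monomial_order X r
  for X :: "'x set" and r +
  fixes S :: "('x list \<Rightarrow> 'k :: {comm_ring, comm_monoid_mult}) set"
  assumes S_carrier: "S \<subseteq> carrier (ncps X)"
    and S_monic: "\<And>s. s \<in> S \<Longrightarrow> monic r s"
begin

text \<open>The coefficient ring may be the zero ring as long as S is empty. An element of S
  excludes this, being nonzero, so 1 and 0 are shown to be distinct relative to such an
  element.\<close>

lemma monic_props:
  assumes "s \<in> S"
  shows S_closed: "s \<in> carrier (ncps X)" and lead_coeff: "s (mt r s) = 1"
    and mt_S_le: "s v \<noteq> 0 \<Longrightarrow> (mt r s, v) \<in> r" and mt_S_word: "mt r s \<in> lists X"
    and one_neq_zero: "(1 :: 'k) \<noteq> 0"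
proof -
  show c: "s \<in> carrier (ncps X)" using assms S_carrier by blast
  have nz: "s \<noteq> (\<lambda>w. 0)" and "s (mt r s) = 1" using S_monic[OF assms] by (auto simp: monic_def)
  then show "s (mt r s) = 1" "s v \<noteq> 0 \<Longrightarrow> (mt r s, v) \<in> r" "mt r s \<in> lists X" "(1 :: 'k) \<noteq> 0"
    using mt_props[OF c nz] by auto
qed

lemma shift_closed:
  "u \<in> lists X \<Longrightarrow> f \<in> carrier (ncps X) \<Longrightarrow> v \<in> lists X \<Longrightarrow> shift X u f v \<in> carrier (ncps X)"
  by (intro ncps_mult_closed word_in_carrier)

lemma shift_lead_coeff: "s \<in> S \<Longrightarrow> shift X u s v (u @ mt r s @ v) = 1"
  using shift_apply[of X u s v "mt r s"] lead_coeff by simp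

text \<open>Admissibility transports the minimality of the leading word of s through multiplication
  by u and v. With \<open>shift_lead_coeff\<close> this identifies the leading word of
  \<open>u s v\<close>.\<close>

lemma shift_mt_le:
  assumes "s \<in> S" "u \<in> lists X" "v \<in> lists X" "shift X u s v w \<noteq> 0"
  shows "(u @ mt r s @ v, w) \<in> r"
proof -
  obtain y where "w = u @ y @ v" "s y \<noteq> 0" using assms(4) by (rule shift_nonzeroD)
  with assms mt_S_le le_mono show ?thesis by blast
qed

text \<open>The predicate restricts the leading words of the multiples. It is used mainly for all
  words, for the words at least w, and for the words greater than w.\<close>

definition mults :: "('x list \<Rightarrow> bool) \<Rightarrow> ('x list \<Rightarrow> 'k) set" where
  "mults P = {shift X u s v |u s v. u \<in> lists X \<and> v \<in> lists X \<and> s \<in> S \<and> P (u @ mt r s @ v)}"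

lemma multsI:
  "u \<in> lists X \<Longrightarrow> v \<in> lists X \<Longrightarrow> s \<in> S \<Longrightarrow> P (u @ mt r s @ v) \<Longrightarrow> shift X u s v \<in> mults P"
  unfolding mults_def by blast

lemma mults_carrier: "mults P \<subseteq> carrier (ncps X)"
  unfolding mults_def using shift_closed S_closed by blast

abbreviation mult_span :: "('x list \<Rightarrow> bool) \<Rightarrow> ('x list \<Rightarrow> 'k) set" where
  "mult_span P \<equiv> closed_span X (mults P)"

lemma shift_in_span:
  "u \<in> lists X \<Longrightarrow> v \<in> lists X \<Longrightarrow> s \<in> S \<Longrightarrow> P (u @ mt r s @ v) \<Longrightarrow> shift X u s v \<in> mult_span P"
  using closed_span_base[OF multsI subsetD[OF mults_carrier multsI]] .

lemma mult_span_left: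
  assumes "f \<in> mult_span P" "g \<in> carrier (ncps X)" "\<And>u w. g u \<noteq> 0 \<Longrightarrow> P w \<Longrightarrow> Q (u @ w)"
  shows "g \<otimes>\<^bsub>ncps X\<^esub> f \<in> mult_span Q"
proof (rule closed_span_mult_left[OF finite_alphabet assms(1,2) mults_carrier])
  fix a q assume a: "g a \<noteq> 0" and "q \<in> mults P"
  then obtain u s v where q: "q = shift X u s v" "u \<in> lists X" "v \<in> lists X" "s \<in> S" "P (u @ mt r s @ v)"
    unfolding mults_def by blast
  have a': "a \<in> lists X" using a assms(2) ncps_carrierD by blast
  then have "word a \<otimes>\<^bsub>ncps X\<^esub> q = shift X (a @ u) s v"
    using q S_closed unfolding word_mult_word[symmetric, of a u X] by (simp add: ncps_mult_assoc)
  moreover have "Q ((a @ u) @ mt r s @ v)" using assms(3)[OF a q(5)] by simp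
  ultimately show "word a \<otimes>\<^bsub>ncps X\<^esub> q \<in> mult_span Q"
    using shift_in_span[of "a @ u" v s Q] q a' by simp
qed

lemma mult_span_right:
  assumes "f \<in> mult_span P" "g \<in> carrier (ncps X)" "\<And>u w. g u \<noteq> 0 \<Longrightarrow> P w \<Longrightarrow> Q (w @ u)"
  shows "f \<otimes>\<^bsub>ncps X\<^esub> g \<in> mult_span Q"
proof (rule closed_span_mult_right[OF finite_alphabet assms(1,2) mults_carrier])
  fix a q assume a: "g a \<noteq> 0" and "q \<in> mults P"
  then obtain u s v where q: "q = shift X u s v" "u \<in> lists X" "v \<in> lists X" "s \<in> S" "P (u @ mt r s @ v)"
    unfolding mults_def by blast
  have a': "a \<in> lists X" using a assms(2) ncps_carrierD by blast
  then have "q \<otimes>\<^bsub>ncps X\<^esub> word a = shift X u s (v @ a)"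
    using q S_closed unfolding word_mult_word[symmetric, of v a X] by (simp add: ncps_mult_assoc)
  moreover have "Q (u @ mt r s @ (v @ a))" using assms(3)[OF a q(5)] by simp
  ultimately show "q \<otimes>\<^bsub>ncps X\<^esub> word a \<in> mult_span Q"
    using shift_in_span[of u "v @ a" s Q] q a' by simp
qed

text \<open>The element s is its own multiple by empty words. Multiplying by g and h turns its
  leading word into words u \<open>mt r s\<close> v with u and v in the supports of g and h.\<close>

lemma product_in_span:
  assumes "s \<in> S" "g \<in> carrier (ncps X)" "h \<in> carrier (ncps X)"
    and "\<And>u v. g u \<noteq> 0 \<Longrightarrow> h v \<noteq> 0 \<Longrightarrow> P (u @ mt r s @ v)"
  shows "g \<otimes>\<^bsub>ncps X\<^esub> s \<otimes>\<^bsub>ncps X\<^esub> h \<in> mult_span P"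
proof -
  let ?Q = "\<lambda>w. w = mt r s" and ?R = "\<lambda>w. \<exists>u. g u \<noteq> 0 \<and> w = u @ mt r s"
  have "shift X [] s [] = s" using assms(1) S_closed by (simp add: word_Nil[of X])
  then have "s \<in> mult_span ?Q" using shift_in_span[of "[]" "[]" s ?Q] assms(1) by simp
  then have "g \<otimes>\<^bsub>ncps X\<^esub> s \<in> mult_span ?R" by (rule mult_span_left) (use assms in auto)
  then show ?thesis by (rule mult_span_right) (use assms in auto)
qed

lemma shift_mult_span:
  assumes "f \<in> mult_span P" "a \<in> lists X" "b \<in> lists X" "\<And>w. P w \<Longrightarrow> Q (a @ w @ b)"
  shows "shift X a f b \<in> mult_span Q"
proof -
  let ?R = "\<lambda>w. \<exists>v. P v \<and> w = a @ v"
  have supp: "word c u \<noteq> (0 :: 'k) \<Longrightarrow> u = c" for c u :: "'x list"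
    by (auto simp: word_def split: if_splits)
  have "word a \<otimes>\<^bsub>ncps X\<^esub> f \<in> mult_span ?R"
    by (rule mult_span_left[OF assms(1)]) (use assms supp in \<open>auto dest!: supp\<close>)
  then show ?thesis by (rule mult_span_right) (use assms supp in \<open>auto dest!: supp\<close>)
qed

lemma topological_sum_in_span:
  assumes "has_topological_sum (ncps X) (ncps_topology X) b N f"
    and "\<And>i. i \<in> N \<Longrightarrow> b i \<in> closed_span X G"
  shows "f \<in> closed_span X G"
proof (rule closed_span_limit)
  have b: "b \<in> N \<rightarrow> carrier (ncps X)" using assms(2) closed_span_carrier by blast
  note iff = assms(1)[unfolded has_topological_sum_ncps[OF finite_alphabet b]]
  then show "f \<in> carrier (ncps X)" by blast
  fix n
  obtain F where F: "finite F" "F \<subseteq> N" "agree n (\<lambda>w. \<Sum>i\<in>F. b i w) f"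
    using iff by (metis order.refl)
  have "(\<lambda>w. \<Sum>i\<in>F. b i w) \<in> closed_span X G"
    using F assms(2) by (intro closed_span_sum) blast
  with F show "\<exists>g\<in>closed_span X G. agree n f g" using agree_sym by blast
qed

text \<open>Words in the supports of the multipliers are at least their leading words, so every
  multiple contributing to a term of the sum has a leading word above w. Only membership in the
  closed span is kept; the sum itself is forgotten.\<close>

lemma trivial_mod_in_span:
  assumes "trivial_mod X r S w f"
  shows "f \<in> mult_span (less w)"
proof -
  obtain N :: "nat set" and g s h where
    "\<forall>i\<in>N. s i \<in> S \<and> g i \<in> carrier (ncps X) - {\<lambda>w. 0} \<and> h i \<in> carrier (ncps X) - {\<lambda>w. 0} \<and>
        less w (mt r (g i) @ mt r (s i) @ mt r (h i))"
    and sum: "has_topological_sum (ncps X) (ncps_topology X)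
        (\<lambda>i. g i \<otimes>\<^bsub>ncps X\<^esub> s i \<otimes>\<^bsub>ncps X\<^esub> h i) N f"
    using assms unfolding trivial_mod_def less_def ncps_simps by (elim exE conjE)
  then have *: "\<And>i. i \<in> N \<Longrightarrow> s i \<in> S" "\<And>i. i \<in> N \<Longrightarrow> g i \<in> carrier (ncps X)" "\<And>i. i \<in> N \<Longrightarrow> g i \<noteq> (\<lambda>w. 0)"
      "\<And>i. i \<in> N \<Longrightarrow> h i \<in> carrier (ncps X)" "\<And>i. i \<in> N \<Longrightarrow> h i \<noteq> (\<lambda>w. 0)"
      "\<And>i. i \<in> N \<Longrightarrow> less w (mt r (g i) @ mt r (s i) @ mt r (h i))"
    by blast+
  show ?thesis
  proof (rule topological_sum_in_span[OF sum])
    fix i assume i: "i \<in> N"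
    show "g i \<otimes>\<^bsub>ncps X\<^esub> s i \<otimes>\<^bsub>ncps X\<^esub> h i \<in> mult_span (less w)"
    proof (rule product_in_span[OF *(1,2,4)[OF i]])
      fix u v assume "g i u \<noteq> 0" "h i v \<noteq> 0"
      then have "(mt r (g i), u) \<in> r" "(mt r (h i), v) \<in> r" "(mt r (s i), mt r (s i)) \<in> r"
        using mt_le[OF *(2,3)[OF i]] mt_le[OF *(4,5)[OF i]] order_refl mt_S_word[OF *(1)[OF i]] by blast+
      then show "less w (u @ mt r (s i) @ v)"
        using less_le_trans[OF *(6)[OF i]] le_append by blast
    qed
  qed
qed

text \<open>Multiplication by series preserves the closed span of all multiples, which is therefore
  an ideal. It contains S and is closed.\<close>

lemma closed_ideal_subset_span: "closed_ideal X S \<subseteq> mult_span (\<lambda>w. True)"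
proof -
  interpret ring "ncps X :: ('k, 'x list \<Rightarrow> 'k) module" by (rule ring_ncps)
  have "ideal (mult_span (\<lambda>w. True)) (ncps X)"
  proof (rule ncps_idealI)
    fix f g :: "'x list \<Rightarrow> 'k" assume "f \<in> mult_span (\<lambda>w. True)" and g: "g \<in> carrier (ncps X)"
    then show "g \<otimes>\<^bsub>ncps X\<^esub> f \<in> mult_span (\<lambda>w. True)" "f \<otimes>\<^bsub>ncps X\<^esub> g \<in> mult_span (\<lambda>w. True)"
      by (rule mult_span_left mult_span_right, simp)+
  next
    show "mult_span (\<lambda>w. True) \<subseteq> carrier (ncps X)" by (rule subsetI) (rule closed_span_carrier)
  next
    show "(\<lambda>w. 0) \<in> mult_span (\<lambda>w. True)" by (rule closed_span_zero)
  next
    fix f g :: "'x list \<Rightarrow> 'k"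
    assume f: "f \<in> mult_span (\<lambda>w. True)"
    then show "(\<lambda>w. - f w) \<in> mult_span (\<lambda>w. True)" by (rule closed_span_uminus)
    assume "g \<in> mult_span (\<lambda>w. True)"
    with f show "(\<lambda>w. f w + g w) \<in> mult_span (\<lambda>w. True)" by (rule closed_span_add)
  qed
  moreover have "S \<subseteq> mult_span (\<lambda>w. True)"
  proof
    fix s assume s: "s \<in> S"
    then have "shift X [] s [] = s" by (simp add: word_Nil[of X] S_closed)
    then show "s \<in> mult_span (\<lambda>w. True)"
      using shift_in_span[where u = "[]" and v = "[]" and s = s and P = "\<lambda>w. True"] s by simp
  qed
  ultimately have sub: "genideal (ncps X) S \<subseteq> mult_span (\<lambda>w. True)" by (rule genideal_minimal)
  show ?thesis
  proof
    fix f assume "f \<in> closed_ideal X S"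
    note f = this[unfolded closed_ideal_iff[OF finite_alphabet S_carrier]]
    show "f \<in> mult_span (\<lambda>w. True)"
    proof (rule closed_span_limit[OF f[THEN conjunct1]])
      show "\<exists>g\<in>mult_span (\<lambda>w. True). agree n f g" for n
        using f[THEN conjunct2, rule_format, of n] sub by auto
    qed
  qed
qed

lemma shift_in_closed_ideal:
  assumes "u \<in> lists X" "v \<in> lists X" "s \<in> S"
  shows "shift X u s v \<in> closed_ideal X S"
proof -
  interpret I: ideal "closed_ideal X S" "ncps X"
    by (rule ideal_closed_ideal[OF finite_alphabet S_carrier])
  have "s \<in> closed_ideal X S" using subset_closed_ideal[OF finite_alphabet S_carrier] assms by blast
  then have "word u \<otimes>\<^bsub>ncps X\<^esub> s \<in> closed_ideal X S"
    by (rule I.I_l_closed[OF _ word_in_carrier[OF assms(1)]])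
  then show ?thesis by (rule I.I_r_closed[OF _ word_in_carrier[OF assms(2)]])
qed

end

section \<open>Compositions\<close>

context monic_set
begin

lemma intersection_eq_shift:
  assumes "f \<in> S" "g \<in> S" "u \<in> lists X" "v \<in> lists X"
  shows "f \<otimes>\<^bsub>ncps X\<^esub> word u \<ominus>\<^bsub>ncps X\<^esub> word v \<otimes>\<^bsub>ncps X\<^esub> g =
    (\<lambda>w. shift X [] f u w - shift X v g [] w)"
proof -
  have "word v \<otimes>\<^bsub>ncps X\<^esub> g \<in> carrier (ncps X)"
    using assms S_closed by (intro ncps_mult_closed word_in_carrier)
  then show ?thesis using assms S_closed by (simp add: ncps_minus word_Nil[of X])
qed

lemma inclusion_eq_shift:
  assumes "f \<in> S" "g \<in> S" "u \<in> lists X" "v \<in> lists X"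
  shows "f \<ominus>\<^bsub>ncps X\<^esub> word u \<otimes>\<^bsub>ncps X\<^esub> g \<otimes>\<^bsub>ncps X\<^esub> word v =
    (\<lambda>w. shift X [] f [] w - shift X u g v w)"
  using shift_closed[OF assms(3) S_closed[OF assms(2)] assms(4)] S_closed[OF assms(1)]
  by (simp add: ncps_minus word_Nil[of X])

text \<open>Both kinds of composition are differences of two multiples with the same leading word w.
  This common form is what the later arguments use.\<close>

lemma composition_shifts:
  assumes "is_composition X r f g w c" "f \<in> S" "g \<in> S"
  obtains a b a' b' where "a \<in> lists X" "b \<in> lists X" "a' \<in> lists X" "b' \<in> lists X"
    "w = a @ mt r f @ b" "w = a' @ mt r g @ b'" "c = (\<lambda>x. shift X a f b x - shift X a' g b' x)"
  using assms(1) unfolding is_composition_def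
proof
  assume "intersection_composition X r f g w c"
  then obtain u v where "u \<in> lists X" "v \<in> lists X" "w = mt r f @ u" "w = v @ mt r g"
      "c = f \<otimes>\<^bsub>ncps X\<^esub> word u \<ominus>\<^bsub>ncps X\<^esub> word v \<otimes>\<^bsub>ncps X\<^esub> g"
    unfolding intersection_composition_def by blast
  then show thesis
    using that[of "[]" u v "[]"] intersection_eq_shift[OF assms(2,3)] by simp
next
  assume "inclusion_composition X r f g w c"
  then obtain u v where "u \<in> lists X" "v \<in> lists X" "w = mt r f" "w = u @ mt r g @ v"
      "c = f \<ominus>\<^bsub>ncps X\<^esub> word u \<otimes>\<^bsub>ncps X\<^esub> g \<otimes>\<^bsub>ncps X\<^esub> word v"
    unfolding inclusion_composition_def by blast
  then show thesis
    using that[of "[]" "[]" u v] inclusion_eq_shift[OF assms(2,3)] by simp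
qed

text \<open>Both multiples have coefficient 1 at w, so these terms cancel; every other term lies
  above w.\<close>

lemma shift_diff_less:
  assumes "s \<in> S" "t \<in> S" "a \<in> lists X" "b \<in> lists X" "a' \<in> lists X" "b' \<in> lists X"
    and "w = a @ mt r s @ b" "w = a' @ mt r t @ b'" "shift X a s b x - shift X a' t b' x \<noteq> 0"
  shows "less w x"
proof -
  have "shift X a s b w = 1" "shift X a' t b' w = 1"
    using shift_lead_coeff assms by metis+
  then have "w \<noteq> x" using assms(9) by auto
  moreover have "shift X a s b x \<noteq> 0 \<or> shift X a' t b' x \<noteq> 0" using assms(9) by auto
  then have "(w, x) \<in> r"
    using shift_mt_le[OF assms(1,3,4), of x] shift_mt_le[OF assms(2,5,6), of x] assms(7,8) by auto
  ultimately show ?thesis by (simp add: less_iff)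
qed

text \<open>Subtracting the leading word with coefficient 1 removes the whole leading term because s
  is monic. Tails are needed where two leading words occur without overlapping.\<close>

definition tail :: "('x list \<Rightarrow> 'k) \<Rightarrow> 'x list \<Rightarrow> 'k" where
  "tail s = (\<lambda>w. s w - word (mt r s) w)"

lemma tail_closed: "s \<in> S \<Longrightarrow> tail s \<in> carrier (ncps X)"
  unfolding tail_def by (intro ncps_diff_closed S_closed word_in_carrier mt_S_word)

lemma tail_less: "s \<in> S \<Longrightarrow> tail s w \<noteq> 0 \<Longrightarrow> less (mt r s) w"
  using lead_coeff mt_S_le[of s w] by (auto simp: tail_def word_def less_iff split: if_splits)

lemma shift_tail:
  "shift X a (tail s) b = (\<lambda>w. shift X a s b w - word (a @ mt r s @ b) w)"
  unfolding tail_def by (simp add: ncps_mult_bilinear word_mult_word)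

text \<open>Write m, n for the leading words of s, t and s', t' for their tails. Then a s e n d - a
  m e t d = a s' e t d - a s e t' d, and on the right each product contains an element of S next to
  a tail, which pushes all leading words above a m e n d. No composition is involved.\<close>

lemma disjoint_diff_in_span:
  assumes S: "s \<in> S" "t \<in> S" and X: "a \<in> lists X" "e \<in> lists X" "d \<in> lists X"
  shows "(\<lambda>x. shift X a s (e @ mt r t @ d) x - shift X (a @ mt r s @ e) t d x)
    \<in> mult_span (less (a @ mt r s @ e @ mt r t @ d))"
proof -
  let ?w = "a @ mt r s @ e @ mt r t @ d" and ?P = "ncps X :: ('k, 'x list \<Rightarrow> 'k) module"
  note c = S_closed[OF S(1)] S_closed[OF S(2)] mt_S_word[OF S(1)] mt_S_word[OF S(2)]
  have wd: "u \<in> lists X \<Longrightarrow> word u \<in> carrier ?P" for u by (rule word_in_carrier)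
  have supp: "word c u \<noteq> (0 :: 'k) \<Longrightarrow> u = c" for c u :: "'x list"
    by (auto simp: word_def split: if_splits)
  have 1: "word a \<otimes>\<^bsub>?P\<^esub> s \<otimes>\<^bsub>?P\<^esub> shift X e (tail t) d \<in> mult_span (less ?w)"
  proof (rule product_in_span[OF S(1) wd[OF X(1)] shift_closed[OF X(2) tail_closed[OF S(2)] X(3)]])
    fix u v assume "word a u \<noteq> (0 :: 'k)" "shift X e (tail t) d v \<noteq> 0"
    then obtain y where y: "v = e @ y @ d" "tail t y \<noteq> 0" "u = a"
      using supp by (meson shift_nonzeroD)
    have "less ((a @ mt r s @ e) @ mt r t @ d) ((a @ mt r s @ e) @ y @ d)"
      using tail_less[OF S(2) y(2)] X c by (intro less_mono) auto
    with y show "less ?w (u @ mt r s @ v)" by simp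
  qed
  have 2: "shift X a (tail s) e \<otimes>\<^bsub>?P\<^esub> t \<otimes>\<^bsub>?P\<^esub> word d \<in> mult_span (less ?w)"
  proof (rule product_in_span[OF S(2) shift_closed[OF X(1) tail_closed[OF S(1)] X(2)] wd[OF X(3)]])
    fix u v assume "shift X a (tail s) e u \<noteq> 0" "word d v \<noteq> (0 :: 'k)"
    then obtain y where y: "u = a @ y @ e" "tail s y \<noteq> 0" "v = d"
      using supp by (meson shift_nonzeroD)
    have "less (a @ mt r s @ (e @ mt r t @ d)) (a @ y @ (e @ mt r t @ d))"
      using tail_less[OF S(1) y(2)] X c by (intro less_mono) auto
    with y show "less ?w (u @ mt r t @ v)" by simp
  qed
  \<comment> \<open>The full product a s e t d; it appears with both signs when the tails are
    expanded and cancels.\<close>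
  let ?M = "word a \<otimes>\<^bsub>?P\<^esub> s \<otimes>\<^bsub>?P\<^esub> shift X e t d"
  have M: "shift X a s e \<otimes>\<^bsub>?P\<^esub> t \<otimes>\<^bsub>?P\<^esub> word d = ?M"
    using c X by (simp add: ncps_mult_assoc)
  have "(\<lambda>x. (shift X a (tail s) e \<otimes>\<^bsub>?P\<^esub> t \<otimes>\<^bsub>?P\<^esub> word d) x -
      (word a \<otimes>\<^bsub>?P\<^esub> s \<otimes>\<^bsub>?P\<^esub> shift X e (tail t) d) x) \<in> mult_span (less ?w)"
    using 2 1 by (rule closed_span_diff)
  also have "(\<lambda>x. (shift X a (tail s) e \<otimes>\<^bsub>?P\<^esub> t \<otimes>\<^bsub>?P\<^esub> word d) x -
      (word a \<otimes>\<^bsub>?P\<^esub> s \<otimes>\<^bsub>?P\<^esub> shift X e (tail t) d) x) =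
    (\<lambda>x. (?M x - shift X (a @ mt r s @ e) t d x) - (?M x - shift X a s (e @ mt r t @ d) x))"
    unfolding shift_tail ncps_mult_bilinear M by (rule refl)
  also have "\<dots> = (\<lambda>x. shift X a s (e @ mt r t @ d) x - shift X (a @ mt r s @ e) t d x)"
    by (simp add: algebra_simps)
  finally show ?thesis .
qed

definition compositions_trivial :: bool where
  "compositions_trivial \<longleftrightarrow> (\<forall>f\<in>S. \<forall>g\<in>S. \<forall>w\<in>lists X. \<forall>c.
    is_composition X r f g w c \<longrightarrow> trivial_mod X r S w c)"

lemma shifted_composition_in_span:
  assumes "compositions_trivial" "s \<in> S" "t \<in> S" "w \<in> lists X" "is_composition X r s t w c"
    and "a \<in> lists X" "b \<in> lists X"
  shows "shift X a c b \<in> mult_span (less (a @ w @ b))"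
proof (rule shift_mult_span)
  have "trivial_mod X r S w c" using assms(1-5) unfolding compositions_trivial_def by blast
  then show "c \<in> mult_span (less w)" by (rule trivial_mod_in_span)
qed (use assms less_mono in auto)

text \<open>The word w carries an occurrence of \<open>mt r s\<close> after a and one of
  \<open>mt r t\<close> after c. Their relative position decides whether the difference is of the
  disjoint kind or a composition multiplied by words on both sides.\<close>

lemma common_multiple_diff_aux:
  assumes triv: "compositions_trivial" and S: "s \<in> S" "t \<in> S"
    and X: "a \<in> lists X" "b \<in> lists X" "c \<in> lists X" "d \<in> lists X"
    and w: "w = a @ mt r s @ b" "w = c @ mt r t @ d" and len: "length a \<le> length c"
  shows "(\<lambda>x. shift X a s b x - shift X c t d x) \<in> mult_span (less w)"
proof -
  note C = S_closed[OF S(1)] S_closed[OF S(2)]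
  obtain e where e: "c = a @ e" "mt r s @ b = e @ mt r t @ d"
  proof -
    have "a @ mt r s @ b = c @ mt r t @ d" using w by simp
    then obtain us where "a = c @ us \<and> us @ mt r s @ b = mt r t @ d \<or>
        a @ us = c \<and> mt r s @ b = us @ mt r t @ d"
      unfolding append_eq_append_conv2[of a] by blast
    \<comment> \<open>In the first alternative the length assumption forces \<open>us\<close> to be
      empty; in the second, \<open>us\<close> is the offset e between the two occurrences.\<close>
    then show thesis
      using len that[of us] by (cases "us = []") auto
  qed
  have eX: "e \<in> lists X" using X e by auto
  \<comment> \<open>The occurrence of \<open>mt r t\<close> starts after the end of
    \<open>mt r s\<close>, or lies inside it, or overhangs its right end by e3.\<close>
  from e(2) consider e' where "e = mt r s @ e'" "b = e' @ mt r t @ d"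
    | d' where "mt r s = e @ mt r t @ d'" "d = d' @ b"
    | e2 e3 where "mt r s = e @ e2" "mt r t = e2 @ e3" "b = e3 @ d"
  proof -
    obtain us where "mt r s = e @ us \<and> us @ b = mt r t @ d \<or> mt r s @ us = e \<and> b = us @ mt r t @ d"
      using e(2) unfolding append_eq_append_conv2[of "mt r s"] by blast
    then show thesis
    proof
      assume us: "mt r s = e @ us \<and> us @ b = mt r t @ d"
      then obtain vs where "us = mt r t @ vs \<and> vs @ b = d \<or> us @ vs = mt r t \<and> b = vs @ d"
        unfolding append_eq_append_conv2[of us] by blast
      then show thesis using us that(2)[of vs] that(3)[of us vs] by auto
    qed (use that(1)[of us] in blast)
  qed
  then show ?thesis
  proof cases
    case 1
    then have "e' \<in> lists X" using X by auto
    then show ?thesis using disjoint_diff_in_span[OF S X(1) _ X(4), of e'] 1 w e by simp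
  next
    case 2
    then have d': "d' \<in> lists X" using X by auto
    let ?c = "\<lambda>x. shift X [] s [] x - shift X e t d' x"
    have "is_composition X r s t (mt r s) ?c"
      unfolding is_composition_def inclusion_composition_def
      using eX d' 2 inclusion_eq_shift[OF S eX d'] by metis
    then have "shift X a ?c b \<in> mult_span (less (a @ mt r s @ b))"
      by (intro shifted_composition_in_span[OF triv S] mt_S_word S X)
    then show ?thesis
      using X C eX d' 2 w e by (simp add: ncps_mult_bilinear shift_shift)
  next
    case 3
    then have e3: "e3 \<in> lists X" using X by auto
    show ?thesis
    proof (cases "e = []")
      case True
      \<comment> \<open>With offset zero, \<open>mt r s\<close> is a prefix of
        \<open>mt r t\<close>, and an intersection composition would require a nonempty left factor.
        The inclusion composition is taken with s and t exchanged, so the sign is reversed at the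
        end.\<close>
      let ?c = "\<lambda>x. shift X [] t [] x - shift X [] s e3 x"
      have t: "mt r t = mt r s @ e3" using 3 True by simp
      have "is_composition X r t s (mt r t) ?c"
        unfolding is_composition_def inclusion_composition_def
        using e3 t inclusion_eq_shift[OF S(2,1) lists.Nil e3]
        by (intro disjI2 bexI[of _ "[]"] bexI[of _ e3]) auto
      then have "shift X a ?c d \<in> mult_span (less (a @ mt r t @ d))"
        by (intro shifted_composition_in_span[OF triv S(2,1)] mt_S_word S X)
      then have "(\<lambda>x. shift X a t d x - shift X a s b x) \<in> mult_span (less w)"
        using X C e3 3 w e True by (simp add: ncps_mult_bilinear shift_shift)
      then have "(\<lambda>x. - (shift X a t d x - shift X a s b x)) \<in> mult_span (less w)"
        by (rule closed_span_uminus)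
      then show ?thesis using True e by simp
    next
      case e_nonempty: False
      show ?thesis
      proof (cases "e3 = []")
        case True
        \<comment> \<open>Without overhang, \<open>mt r t\<close> is a suffix of
          \<open>mt r s\<close>; again only an inclusion composition is available.\<close>
        let ?c = "\<lambda>x. shift X [] s [] x - shift X e t [] x"
        have s: "mt r s = e @ mt r t @ []" using 3 True by simp
        have "is_composition X r s t (mt r s) ?c"
          unfolding is_composition_def inclusion_composition_def
          using eX s inclusion_eq_shift[OF S eX lists.Nil]
          by (intro disjI2 bexI[of _ e] bexI[of _ "[]"]) auto
        then have "shift X a ?c b \<in> mult_span (less (a @ mt r s @ b))"
          by (intro shifted_composition_in_span[OF triv S] mt_S_word S X)
        then show ?thesis
          using X C eX 3 w e True by (simp add: ncps_mult_bilinear shift_shift)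
      next
        case False
        let ?c = "\<lambda>x. shift X [] s e3 x - shift X e t [] x"
        have s: "mt r s @ e3 = e @ mt r t" using 3 by simp
        have "is_composition X r s t (mt r s @ e3) ?c"
          unfolding is_composition_def intersection_composition_def
          using eX e3 e_nonempty False s intersection_eq_shift[OF S e3 eX]
          by (intro disjI1 bexI[of _ e3] bexI[of _ e]) auto
        then have "shift X a ?c d \<in> mult_span (less (a @ (mt r s @ e3) @ d))"
          using mt_S_word[OF S(1)] e3
          by (intro shifted_composition_in_span[OF triv S] S X) auto
        then show ?thesis
          using X C eX e3 3 w e by (simp add: ncps_mult_bilinear shift_shift)
      qed
    qed
  qed
qed

lemma common_multiple_diff:
  assumes "compositions_trivial" "s \<in> S" "t \<in> S"
    and "a \<in> lists X" "b \<in> lists X" "c \<in> lists X" "d \<in> lists X"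
    and "w = a @ mt r s @ b" "w = c @ mt r t @ d"
  shows "(\<lambda>x. shift X a s b x - shift X c t d x) \<in> mult_span (less w)"
proof (cases "length a \<le> length c")
  case True
  then show ?thesis using common_multiple_diff_aux assms by blast
next
  case False
  then have "(\<lambda>x. shift X c t d x - shift X a s b x) \<in> mult_span (less w)"
    using common_multiple_diff_aux[OF assms(1,3,2,6,7,4,5,9,8)] by simp
  then have "(\<lambda>x. - (shift X c t d x - shift X a s b x)) \<in> mult_span (less w)"
    by (rule closed_span_uminus)
  then show ?thesis by simp
qed

section \<open>Rewriting towards larger leading words\<close>

lemma mults_word:
  assumes "g \<in> mults P"
  obtains u s v where "g = shift X u s v" "u \<in> lists X" "v \<in> lists X" "s \<in> S" "P (u @ mt r s @ v)"
    "u @ mt r s @ v \<in> lists X"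
  using assms mt_S_word unfolding mults_def by auto

lemma mults_mono:
  assumes "\<And>w. w \<in> lists X \<Longrightarrow> P w \<Longrightarrow> Q w"
  shows "mults P \<subseteq> mults Q"
proof
  fix g assume "g \<in> mults P"
  then show "g \<in> mults Q" by (rule mults_word) (use assms multsI in auto)
qed

text \<open>
  All multiples with leading word \<open>w\<close> are congruent modulo multiples with larger leading words,
  so a series whose \<open>w\<close>-coefficient vanishes does not need them.
\<close>

lemma raise_leading_word:
  assumes triv: "compositions_trivial" and w: "w \<in> lists X"
    and f: "f \<in> mult_span (\<lambda>v. (w, v) \<in> r)" "f w = 0"
  shows "f \<in> mult_span (less w)"
proof (cases "\<exists>u\<in>lists X. \<exists>v\<in>lists X. \<exists>s\<in>S. u @ mt r s @ v = w")
  case False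
  have "mults (\<lambda>v. (w, v) \<in> r) \<subseteq> mults (less w)"
  proof
    fix g assume "g \<in> mults (\<lambda>v. (w, v) \<in> r)"
    then obtain u s v where g: "g = shift X u s v" "u \<in> lists X" "v \<in> lists X" "s \<in> S"
      "(w, u @ mt r s @ v) \<in> r" by (rule mults_word)
    then have "less w (u @ mt r s @ v)" using False by (auto simp: less_iff)
    with g show "g \<in> mults (less w)" by (auto intro: multsI)
  qed
  then show ?thesis using closed_span_mono f by blast
next
  case True
  then obtain a b t where t: "a \<in> lists X" "b \<in> lists X" "t \<in> S" "w = a @ mt r t @ b" by metis
  let ?q = "shift X a t b"
  \<comment> \<open>The fixed multiple q represents all multiples with leading word w. Each such
    generator has coefficient 1 at w and the others have coefficient 0 there, so the coefficient of
    l at w counts the copies of q to be removed.\<close>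
  have red: "(\<lambda>x. l x - l w * ?q x) \<in> mult_span (less w)" if "l \<in> lin_span (mults (\<lambda>v. (w, v) \<in> r))" for l
    using that
  proof induction
    case zero
    then show ?case by (simp add: closed_span_zero)
  next
    case (step l g c)
    obtain u s v where g: "g = shift X u s v" "u \<in> lists X" "v \<in> lists X" "s \<in> S"
      "(w, u @ mt r s @ v) \<in> r" using step(2) by (rule mults_word)
    have "(\<lambda>x. g x - g w * ?q x) \<in> mult_span (less w)"
    proof (cases "u @ mt r s @ v = w")
      case True
      then have "g w = 1" using shift_lead_coeff[OF g(4), of u v] g(1) by simp
      then show ?thesis
        using common_multiple_diff[OF triv g(4) t(3) g(2,3) t(1,2) True[symmetric] t(4)] g(1) by simp
    next
      case False
      then have "g w = 0"
        using shift_mt_le[OF g(4) g(2,3), of w] g(1,5) order_antisym by blast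
      moreover have "less w (u @ mt r s @ v)" using False g(5) by (auto simp: less_iff)
      ultimately show ?thesis using shift_in_span[OF g(2,3,4)] g(1) by simp
    qed
    then have "(\<lambda>x. (l x - l w * ?q x) + c * (g x - g w * ?q x)) \<in> mult_span (less w)"
      using step.IH by (intro closed_span_add closed_span_smult)
    also have "(\<lambda>x. (l x - l w * ?q x) + c * (g x - g w * ?q x)) =
        (\<lambda>x. (l x + c * g x) - (l w + c * g w) * ?q x)"
      by (simp add: algebra_simps)
    finally show ?case .
  qed
  show ?thesis
  proof (rule closed_span_limit[OF closed_span_carrier[OF f(1)]])
    fix n
    \<comment> \<open>The precision exceeds the length of w, so the approximation inherits the
      vanishing coefficient at w.\<close>
    obtain l where l: "l \<in> lin_span (mults (\<lambda>v. (w, v) \<in> r))" "agree (max n (Suc (length w))) f l"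
      using f(1) by (rule closed_span_approx)
    have "l w = 0" using agreeD[OF l(2), of w] f(2) by simp
    then have "l \<in> mult_span (less w)" using red[OF l(1)] by simp
    then show "\<exists>g\<in>mult_span (less w). agree n f g" using agree_mono[OF l(2), of n] by auto
  qed
qed

text \<open>If the leading word m of f were irreducible, raising the lower bound past every word
  below m would place f in the closed span of multiples with leading words at least m. None of these
  has leading word m itself, so all of them, and hence f, vanish at m.\<close>

lemma mt_in_word_ideal:
  assumes triv: "compositions_trivial" and f: "f \<in> closed_ideal X S" "f \<noteq> (\<lambda>w. 0)"
  shows "mt r f \<in> word_ideal X (mt r ` S)"
proof (rule ccontr)
  let ?m = "mt r f" and ?ge = "\<lambda>w v. (w, v) \<in> r"
  assume m: "?m \<notin> word_ideal X (mt r ` S)"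
  have fs: "f \<in> mult_span (\<lambda>w. True)" by (rule subsetD[OF closed_ideal_subset_span f(1)])
  then have fc: "f \<in> carrier (ncps X)" by (rule closed_span_carrier)
  note mt = mt_nonzero[OF fc f(2)] mt_le[OF fc f(2)] mt_word[OF fc f(2)]
  have "(w, ?m) \<in> r \<longrightarrow> f \<in> mult_span (?ge w)" for w
  proof (induction w rule: wf_induct_rule[OF wf_less])
    case (1 w)
    show ?case
    proof
      assume wm: "(w, ?m) \<in> r"
      then have wX: "w \<in> lists X" using order_subset by blast
      show "f \<in> mult_span (?ge w)"
      \<comment> \<open>For the least word the lower bound is no restriction.\<close>
      proof (cases "{v. less v w} = {}")
        case True
        then have "mults (\<lambda>w. True) \<subseteq> mults (?ge w)"
          using not_less[OF _ wX] by (intro mults_mono) blast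
        then show ?thesis using subsetD[OF closed_span_mono fs] by blast
      next
        case False
        have fin: "finite {v. less v w}"
          by (rule finite_subset[OF _ finite_below[of w]]) (auto simp: less_iff)
        have sub: "{v. less v w} \<subseteq> lists X" using less_words(1) by blast
        \<comment> \<open>The immediate predecessor p of w: words above p are exactly the words at
          least w, and f vanishes at p because p lies below its leading word.\<close>
        obtain p where "p \<in> {v. less v w}" "\<And>v. v \<in> {v. less v w} \<Longrightarrow> (v, p) \<in> r"
          by (rule greatest_word[OF fin False sub]) blast
        then have p: "less p w" "\<And>v. less v w \<Longrightarrow> (v, p) \<in> r" by simp_all
        have pm: "less p ?m" using p(1) wm by (rule less_le_trans)
        then have "f p = 0" using mt(2)[of p] order_antisym by (auto simp: less_iff)
        moreover have "f \<in> mult_span (?ge p)" using 1[of p] p(1) pm by (auto simp: less_iff)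
        ultimately have "f \<in> mult_span (less p)"
          using raise_leading_word[OF triv] less_words(1)[OF p(1)] by blast
        moreover have "mults (less p) \<subseteq> mults (?ge w)"
        proof (rule mults_mono)
          fix v assume v: "v \<in> lists X" "less p v"
          then have "\<not> less v w" using p(2)[of v] order_antisym by (auto simp: less_iff)
          then show "?ge w v" using not_less v wX by blast
        qed
        ultimately show ?thesis using subsetD[OF closed_span_mono] by blast
      qed
    qed
  qed
  then have "f \<in> mult_span (?ge ?m)" using order_refl mt(3) by blast
  then obtain l where l: "l \<in> lin_span (mults (?ge ?m))" "agree (Suc (length ?m)) f l"
    by (rule closed_span_approx)
  from l(1) have "l ?m = 0"
  proof induction
    case (step l g a)
    obtain u s v where g: "g = shift X u s v" "u \<in> lists X" "v \<in> lists X" "s \<in> S"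
      "(?m, u @ mt r s @ v) \<in> r" using step(2) by (rule mults_word)
    have "u @ mt r s @ v \<noteq> ?m" using m g by (force simp: word_ideal_def)
    then have "g ?m = 0" using shift_mt_le[OF g(4,2,3), of ?m] g(1,5) order_antisym by blast
    then show ?case using step.IH by simp
  qed simp
  then show False using agreeD[OF l(2), of ?m] mt(1) by simp
qed

end

section \<open>Normal forms\<close>

text \<open>Normal forms are indexed by words, whereas \<open>trivial_mod\<close> asks for natural
  numbers as indices. Finite index sets correspond under an injection.\<close>

lemma has_topological_sum_reindex:
  fixes b :: "'i \<Rightarrow> 'x list \<Rightarrow> 'k :: {comm_ring, comm_monoid_mult}"
  assumes X: "finite X" and b: "b \<in> N \<rightarrow> carrier (ncps X)" and e: "inj_on e N"
    and sum: "has_topological_sum (ncps X) (ncps_topology X) b N f"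
  shows "has_topological_sum (ncps X) (ncps_topology X) (\<lambda>i. b (inv_into N e i)) (e ` N) f"
proof -
  let ?b = "\<lambda>i. b (inv_into N e i)"
  have b': "?b \<in> e ` N \<rightarrow> carrier (ncps X)" using b e by auto
  note sum' = sum[unfolded has_topological_sum_ncps[OF X b]]
  show ?thesis
    unfolding has_topological_sum_ncps[OF X b']
  proof (intro conjI allI)
    fix n
    obtain F where F: "finite F" "F \<subseteq> N"
      "\<And>F'. finite F' \<and> F \<subseteq> F' \<and> F' \<subseteq> N \<Longrightarrow> agree n (\<lambda>w. \<Sum>i\<in>F'. b i w) f"
      using sum' by meson
    have "agree n (\<lambda>w. \<Sum>i\<in>F'. ?b i w) f" if F': "finite F'" "e ` F \<subseteq> F'" "F' \<subseteq> e ` N" for F'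
    proof -
      have inj: "inj_on (inv_into N e) F'" using F'(3) by (rule inj_on_inv_into)
      have "F \<subseteq> inv_into N e ` F'"
      proof
        fix x assume x: "x \<in> F"
        then have "inv_into N e (e x) = x" using F(2) e by (simp add: inv_into_f_f subset_iff)
        then show "x \<in> inv_into N e ` F'" using F'(2) x by (metis image_eqI imageI subsetD)
      qed
      moreover have "inv_into N e ` F' \<subseteq> N" using F'(3) by (auto intro: inv_into_into)
      ultimately have "agree n (\<lambda>w. \<Sum>i\<in>inv_into N e ` F'. b i w) f" using F(3) F'(1) by simp
      then show ?thesis by (simp add: sum.reindex[OF inj])
    qed
    then show "\<exists>F. finite F \<and> F \<subseteq> e ` N \<and>
        (\<forall>F'. finite F' \<and> F \<subseteq> F' \<and> F' \<subseteq> e ` N \<longrightarrow> agree n (\<lambda>w. \<Sum>i\<in>F'. ?b i w) f)"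
      using F(1,2) by (intro exI[of _ "e ` F"]) (simp add: image_mono)
  qed (use sum' in blast)
qed

context monic_set
begin

abbreviation J :: "('x list \<Rightarrow> 'k) set" where "J \<equiv> closed_ideal X S"

abbreviation reducible :: "'x list set" where "reducible \<equiv> word_ideal X (mt r ` S)"

lemma reducible_words: "reducible \<subseteq> lists X"
proof
  fix w assume "w \<in> reducible"
  then obtain u s v where "w = u @ mt r s @ v" "u \<in> lists X" "v \<in> lists X" "s \<in> S"
    unfolding word_ideal_def by blast
  then show "w \<in> lists X" using mt_S_word[of s] by simp
qed

lemma J_carrier: "f \<in> J \<Longrightarrow> f \<in> carrier (ncps X)"
  unfolding closed_ideal_iff[OF finite_alphabet S_carrier] by (rule conjunct1)

lemma J_add: "f \<in> J \<Longrightarrow> g \<in> J \<Longrightarrow> (\<lambda>w. f w + g w) \<in> J"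
  using additive_subgroup.a_closed[OF ideal.axioms(1)[OF ideal_closed_ideal[OF finite_alphabet S_carrier]], of f g]
  by simp

lemma J_zero: "(\<lambda>w. 0) \<in> J"
  using additive_subgroup.zero_closed[OF ideal.axioms(1)[OF ideal_closed_ideal[OF finite_alphabet S_carrier]]]
  by simp

lemma J_smult:
  assumes "f \<in> J" shows "(\<lambda>w. a * f w) \<in> J"
proof -
  \<comment> \<open>A scalar acts as multiplication by a constant series.\<close>
  have "(\<lambda>w. a * word [] w) \<otimes>\<^bsub>ncps X\<^esub> f \<in> J"
    using ideal.I_l_closed[OF ideal_closed_ideal[OF finite_alphabet S_carrier] assms]
      ncps_smult_closed[OF word_in_carrier[OF lists.Nil]] by blast
  then show ?thesis
    using J_carrier[OF assms] by (simp add: ncps_mult_bilinear word_Nil[of X])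
qed

lemma J_diff: "f \<in> J \<Longrightarrow> g \<in> J \<Longrightarrow> (\<lambda>w. f w - g w) \<in> J"
  using J_add[of f "\<lambda>w. - 1 * g w"] J_smult[of g "- 1"] by simp

lemma J_uminus: "f \<in> J \<Longrightarrow> (\<lambda>w. - f w) \<in> J"
  using J_smult[of f "- 1"] by simp

lemma J_limit:
  "f \<in> carrier (ncps X) \<Longrightarrow> (\<And>n. \<exists>g\<in>J. agree n f g) \<Longrightarrow> f \<in> J"
  by (rule closed_ideal_limit[OF finite_alphabet S_carrier])

lemma J_sum: "(\<And>i. i \<in> F \<Longrightarrow> b i \<in> J) \<Longrightarrow> (\<lambda>w. \<Sum>i\<in>F. b i w) \<in> J"
  by (induction F rule: infinite_finite_induct) (auto intro: J_add J_zero)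

lemma J_topological_sum:
  assumes "has_topological_sum (ncps X) (ncps_topology X) b N f" "\<And>i. i \<in> N \<Longrightarrow> b i \<in> J"
  shows "f \<in> J"
proof -
  have b: "b \<in> N \<rightarrow> carrier (ncps X)" using assms(2) J_carrier by blast
  note sum = assms(1)[unfolded has_topological_sum_ncps[OF finite_alphabet b]]
  show ?thesis
  proof (rule J_limit)
    fix n
    obtain F where F: "F \<subseteq> N" "agree n (\<lambda>w. \<Sum>i\<in>F. b i w) f"
      using sum by (metis order.refl)
    have "(\<lambda>w. \<Sum>i\<in>F. b i w) \<in> J" using F(1) assms(2) by (intro J_sum) blast
    then show "\<exists>g\<in>J. agree n f g" using agree_sym[OF F(2)] by blast
  qed (use sum in blast)
qed

text \<open>One inclusion of the definition always holds: a reducible word is the leading word of a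
  multiple of an element of S, and this multiple lies in the closed ideal.\<close>

lemma GS_basis_iff: "GS_basis X r S \<longleftrightarrow> (\<forall>f\<in>J. f \<noteq> (\<lambda>w. 0) \<longrightarrow> mt r f \<in> reducible)"
proof -
  have "w \<in> mt r ` (J - {\<lambda>w. 0})" if "w \<in> reducible" for w
  proof -
    obtain u s v where w: "w = u @ mt r s @ v" "u \<in> lists X" "v \<in> lists X" "s \<in> S"
      using \<open>w \<in> reducible\<close> unfolding word_ideal_def by blast
    have 1: "shift X u s v w = 1" using shift_lead_coeff[OF w(4)] w(1) by simp
    then have "shift X u s v \<noteq> (\<lambda>w. 0)" using one_neq_zero[OF w(4)] by auto
    moreover have "mt r (shift X u s v) = w"
      using 1 one_neq_zero[OF w(4)] shift_mt_le[OF w(4,2,3)] w(1) by (intro mt_eqI) simp_all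
    ultimately show ?thesis using shift_in_closed_ideal[OF w(2,3,4)] by blast
  qed
  then show ?thesis using S_monic unfolding GS_basis_def ncps_simps by blast
qed

text \<open>
  The chosen multiples \<open>U w \<cdot> T w \<cdot> V w\<close> with leading word \<open>w\<close> form a triangular
  family, so the coefficients \<open>c\<close> are determined by recursion along the well-founded word order.
\<close>

lemma normal_form:
  assumes f: "f \<in> carrier (ncps X)"
  obtains c U T V g where
    "\<And>w. w \<in> reducible \<Longrightarrow> U w \<in> lists X" "\<And>w. w \<in> reducible \<Longrightarrow> V w \<in> lists X"
    "\<And>w. w \<in> reducible \<Longrightarrow> T w \<in> S" "\<And>w. w \<in> reducible \<Longrightarrow> w = U w @ mt r (T w) @ V w"
    "has_topological_sum (ncps X) (ncps_topology X) (\<lambda>w x. c w * shift X (U w) (T w) (V w) x)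
      {w \<in> reducible. c w \<noteq> 0} g"
    "g \<in> J" "\<And>w. w \<in> reducible \<Longrightarrow> g w = f w"
    "\<And>w. w \<in> reducible \<Longrightarrow> c w \<noteq> 0 \<Longrightarrow> (mt r f, w) \<in> r"
    "mt r f \<notin> reducible \<Longrightarrow> g (mt r f) = 0"
proof -
  have "\<forall>w\<in>reducible. \<exists>p. fst p \<in> lists X \<and> snd (snd p) \<in> lists X \<and> fst (snd p) \<in> S \<and>
      w = fst p @ mt r (fst (snd p)) @ snd (snd p)"
    unfolding word_ideal_def by force
  from bchoice[OF this] obtain p where p: "\<forall>w\<in>reducible. fst (p w) \<in> lists X \<and>
      snd (snd (p w)) \<in> lists X \<and> fst (snd (p w)) \<in> S \<and>
      w = fst (p w) @ mt r (fst (snd (p w))) @ snd (snd (p w))" ..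
  define U T V where "U w = fst (p w)" and "T w = fst (snd (p w))" and "V w = snd (snd (p w))" for w
  have UTV: "\<And>w. w \<in> reducible \<Longrightarrow> U w \<in> lists X" "\<And>w. w \<in> reducible \<Longrightarrow> V w \<in> lists X"
    "\<And>w. w \<in> reducible \<Longrightarrow> T w \<in> S" "\<And>w. w \<in> reducible \<Longrightarrow> w = U w @ mt r (T w) @ V w"
    using p unfolding U_def T_def V_def by blast+
  define q where "q w = shift X (U w) (T w) (V w)" for w
  have q_lead: "q w w = 1" if "w \<in> reducible" for w
    using shift_lead_coeff[OF UTV(3)[OF that], of "U w" "V w"] UTV(4)[OF that] by (simp add: q_def)
  have q_le: "(w, x) \<in> r" if "w \<in> reducible" "q w x \<noteq> 0" for w x
    using shift_mt_le[OF UTV(3,1,2)[OF that(1)], of x] UTV(4)[OF that(1)] that(2) by (simp add: q_def)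
  have q_J: "q w \<in> J" if "w \<in> reducible" for w
    unfolding q_def by (rule shift_in_closed_ideal[OF UTV(1,2,3)[OF that]])
  \<comment> \<open>The system is unitriangular because q w has coefficient 1 at w: c w is what
    remains of f w after the contributions of all smaller reducible words.\<close>
  define c where "c = wfrec {(u, v). less u v}
    (\<lambda>c w. f w - (\<Sum>v\<in>{v \<in> reducible. less v w}. c v * q v w))"
  have c: "c w = f w - (\<Sum>v\<in>{v \<in> reducible. less v w}. c v * q v w)" for w
  proof -
    have "c w = f w - (\<Sum>v\<in>{v \<in> reducible. less v w}. cut c {(u, v). less u v} w v * q v w)"
      unfolding c_def by (subst wfrec[OF wf_less]) (rule refl)
    also have "(\<Sum>v\<in>{v \<in> reducible. less v w}. cut c {(u, v). less u v} w v * q v w) =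
        (\<Sum>v\<in>{v \<in> reducible. less v w}. c v * q v w)"
      by (rule sum.cong) (simp_all add: cut_apply)
    finally show ?thesis .
  qed
  \<comment> \<open>The candidate limit, given pointwise by finite sums: q v vanishes at w unless v
    is at most w.\<close>
  define g where "g w = (\<Sum>v\<in>{v \<in> reducible. (v, w) \<in> r}. c v * q v w)" for w
  have g_red: "g w = f w" if w: "w \<in> reducible" for w
  proof -
    have "{v \<in> reducible. (v, w) \<in> r} = insert w {v \<in> reducible. less v w}"
      using w order_refl reducible_words by (auto simp: less_iff)
    moreover have "finite {v \<in> reducible. less v w}"
      by (rule finite_subset[OF _ finite_below[of w]]) (auto simp: less_iff)
    ultimately have "g w = c w * q w w + (\<Sum>v\<in>{v \<in> reducible. less v w}. c v * q v w)"
      unfolding g_def by (simp add: less_iff)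
    then show ?thesis using q_lead[OF w] c[of w] by simp
  qed
  \<comment> \<open>A coefficient can become nonzero only through f at the same word or through a
    nonzero coefficient at a smaller word, and f has no terms below its leading word.\<close>
  have c_ge: "(mt r f, w) \<in> r" if "w \<in> reducible" "c w \<noteq> 0" for w
    using that
  proof (induction w rule: wf_induct_rule[OF wf_less])
    case (1 w)
    from c[of w] 1(3) consider "f w \<noteq> 0" | "(\<Sum>v\<in>{v \<in> reducible. less v w}. c v * q v w) \<noteq> 0"
      by fastforce
    then show ?case
    proof cases
      case 1
      then have "f \<noteq> (\<lambda>w. 0)" by auto
      then show ?thesis using mt_le[OF f] 1 by blast
    next
      case 2
      then obtain v where "v \<in> reducible" "less v w" "c v * q v w \<noteq> 0"
        by (metis (no_types, lifting) mem_Collect_eq sum.neutral)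
      moreover from this have "c v \<noteq> 0" by auto
      ultimately show ?thesis using "1.IH"[of v] order_trans by (auto simp: less_iff)
    qed
  qed
  have "g (mt r f) = 0" if m: "mt r f \<notin> reducible"
    unfolding g_def
  proof (rule sum.neutral, intro ballI)
    fix v assume v: "v \<in> {v \<in> reducible. (v, mt r f) \<in> r}"
    then have "c v = 0" using c_ge[of v] order_antisym[of v "mt r f"] m by auto
    then show "c v * q v (mt r f) = 0" by simp
  qed
  moreover have sum: "has_topological_sum (ncps X) (ncps_topology X) (\<lambda>w x. c w * q w x)
      {w \<in> reducible. c w \<noteq> 0} g"
  proof -
    let ?N = "{w \<in> reducible. c w \<noteq> 0}"
    have N: "(\<lambda>w x. c w * q w x) \<in> ?N \<rightarrow> carrier (ncps X)"
      using ncps_smult_closed[OF J_carrier[OF q_J]] by blast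
    show ?thesis
      unfolding has_topological_sum_ncps[OF finite_alphabet N]
    proof (intro conjI allI)
      have "g w = 0" if "w \<notin> lists X" for w
        using that order_subset unfolding g_def by (intro sum.neutral) auto
      then show "g \<in> carrier (ncps X)" by (simp add: ncps_carrier_iff)
      fix n
      \<comment> \<open>Multiples with leading words outside this finite set have no terms of length
        less than n.\<close>
      let ?F = "{w \<in> ?N. \<exists>v. length v < n \<and> (w, v) \<in> r}"
      have "agree n (\<lambda>x. \<Sum>w\<in>F'. c w * q w x) g" if F': "finite F'" "?F \<subseteq> F'" "F' \<subseteq> ?N" for F'
        unfolding agree_def
      proof (intro allI impI)
        fix x :: "'x list" assume x: "length x < n"
        let ?B = "{v \<in> reducible. (v, x) \<in> r}"
        have B: "finite ?B" by (rule finite_subset[OF _ finite_below[of x]]) auto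
        have "(\<Sum>w\<in>F'. c w * q w x) = (\<Sum>w\<in>F' \<inter> ?B. c w * q w x)"
        proof (rule sum.mono_neutral_right[OF F'(1)])
          show "\<forall>w\<in>F' - F' \<inter> ?B. c w * q w x = 0"
          proof
            fix w assume "w \<in> F' - F' \<inter> ?B"
            then have "q w x = 0" using F'(3) q_le[of w x] by blast
            then show "c w * q w x = 0" by simp
          qed
        qed auto
        also have "\<dots> = (\<Sum>w\<in>?B. c w * q w x)"
        proof (rule sum.mono_neutral_left[OF B])
          show "\<forall>w\<in>?B - F' \<inter> ?B. c w * q w x = 0"
          proof
            fix w assume "w \<in> ?B - F' \<inter> ?B"
            then have "c w = 0" using F'(2) x by blast
            then show "c w * q w x = 0" by simp
          qed
        qed auto
        finally show "(\<Sum>w\<in>F'. c w * q w x) = g x" by (simp add: g_def)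
      qed
      moreover have "finite ?F" by (rule finite_subset[OF _ finite_le_short[of n]]) auto
      ultimately show "\<exists>F. finite F \<and> F \<subseteq> ?N \<and>
          (\<forall>F'. finite F' \<and> F \<subseteq> F' \<and> F' \<subseteq> ?N \<longrightarrow> agree n (\<lambda>x. \<Sum>w\<in>F'. c w * q w x) g)"
        by (intro exI[of _ ?F]) auto
    qed
  qed
  moreover have "g \<in> J" using J_topological_sum[OF sum] J_smult[OF q_J] by simp
  ultimately show thesis
    using that[of U V T c g] UTV g_red c_ge unfolding q_def by simp
qed

section \<open>Triviality from normal forms\<close>

lemma mt_smult_word:
  fixes a :: 'k assumes "a \<noteq> 0" "u \<in> lists X"
  shows "mt r (\<lambda>w. a * word u w) = u"
  using assms order_refl by (intro mt_eqI) (auto simp: word_def split: if_splits)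

text \<open>The difference of f and its reducible part g lies in the closed ideal and vanishes at
  all reducible words; a nonzero difference would have a reducible leading word. So f equals g,
  which is an explicit sum of multiples with leading words at least \<open>mt r f\<close>.\<close>

lemma GS_imp_trivial_mod:
  assumes GS: "GS_basis X r S" and f: "f \<in> J" "f \<noteq> (\<lambda>w. 0)" and w: "less w (mt r f)"
  shows "trivial_mod X r S w f"
proof -
  obtain c U T V g where nf:
    "\<And>w. w \<in> reducible \<Longrightarrow> U w \<in> lists X" "\<And>w. w \<in> reducible \<Longrightarrow> V w \<in> lists X"
    "\<And>w. w \<in> reducible \<Longrightarrow> T w \<in> S" "\<And>w. w \<in> reducible \<Longrightarrow> w = U w @ mt r (T w) @ V w"
    and sum: "has_topological_sum (ncps X) (ncps_topology X) (\<lambda>w x. c w * shift X (U w) (T w) (V w) x)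
      {w \<in> reducible. c w \<noteq> 0} g"
    and g: "g \<in> J" "\<And>w. w \<in> reducible \<Longrightarrow> g w = f w"
      "\<And>w. w \<in> reducible \<Longrightarrow> c w \<noteq> 0 \<Longrightarrow> (mt r f, w) \<in> r"
    by (rule normal_form[OF J_carrier[OF f(1)]]) blast
  define h where "h = (\<lambda>w. f w - g w)"
  have "h = (\<lambda>w. 0)"
  proof (rule ccontr)
    assume "h \<noteq> (\<lambda>w. 0)"
    moreover have h: "h \<in> J" unfolding h_def by (rule J_diff[OF f(1) g(1)])
    ultimately have "mt r h \<in> reducible" "h (mt r h) \<noteq> 0"
      using GS mt_nonzero[OF J_carrier[OF h]] unfolding GS_basis_iff by blast+
    then show False using g(2) by (simp add: h_def)
  qed
  then have "f = g" by (auto simp: h_def fun_eq_iff)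
  let ?N = "{w \<in> reducible. c w \<noteq> 0}"
  \<comment> \<open>The rank of a word in the order numbers the terms.\<close>
  let ?e = "\<lambda>w. card {v. (v, w) \<in> r}"
  let ?i = "inv_into ?N ?e"
  have inj: "inj_on ?e ?N"
  proof (rule inj_onI, rule ccontr)
    fix x y assume xy: "x \<in> ?N" "y \<in> ?N" "?e x = ?e y" "x \<noteq> y"
    have "less x y \<or> less y x"
      using xy reducible_words order_total[of x y] by (auto simp: less_iff)
    then show False using card_below_less[of x y] card_below_less[of y x] xy(3) by auto
  qed
  \<comment> \<open>The scalar goes into the left multiplier, which must be nonzero; this is why
    only words with c w nonzero serve as indices.\<close>
  let ?g = "\<lambda>w x. c w * word (U w) x" and ?h = "\<lambda>w. word (V w) :: 'x list \<Rightarrow> 'k"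
  have prod: "?g w \<otimes>\<^bsub>ncps X\<^esub> T w \<otimes>\<^bsub>ncps X\<^esub> ?h w = (\<lambda>x. c w * shift X (U w) (T w) (V w) x)" for w
    by (simp add: ncps_mult_bilinear)
  have carrier: "(\<lambda>w x. c w * shift X (U w) (T w) (V w) x) \<in> ?N \<rightarrow> carrier (ncps X)"
    using ncps_smult_closed[OF shift_closed[OF nf(1) S_closed[OF nf(3)] nf(2)]] by blast
  have "has_topological_sum (ncps X) (ncps_topology X)
      (\<lambda>i. ?g (?i i) \<otimes>\<^bsub>ncps X\<^esub> T (?i i) \<otimes>\<^bsub>ncps X\<^esub> ?h (?i i)) (?e ` ?N) f"
    unfolding prod \<open>f = g\<close>
    using has_topological_sum_reindex[OF finite_alphabet carrier inj sum] .
  moreover have "\<forall>i\<in>?e ` ?N. T (?i i) \<in> S \<and>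
      ?g (?i i) \<in> carrier (ncps X) - {\<zero>\<^bsub>ncps X\<^esub>} \<and> ?h (?i i) \<in> carrier (ncps X) - {\<zero>\<^bsub>ncps X\<^esub>} \<and>
      (w, mt r (?g (?i i)) @ mt r (T (?i i)) @ mt r (?h (?i i))) \<in> r - Id"
  proof
    fix i assume "i \<in> ?e ` ?N"
    then have "?i i \<in> ?N" by (rule inv_into_into)
    then obtain v where v: "v = ?i i" "v \<in> reducible" "c v \<noteq> 0" by blast
    note nf = nf[OF v(2)] and nz = one_neq_zero[OF nf(3)]
    have "?g v \<noteq> (\<lambda>w. 0)" "?h v \<noteq> (\<lambda>w. 0)"
      using v(3) nz by (auto simp: word_def fun_eq_iff)
    moreover have "mt r (?g v) = U v" "mt r (?h v) = V v"
      using mt_smult_word[OF v(3) nf(1)] mt_smult_word[OF nz nf(2)] by simp_all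
    moreover have "less w v" using w g(3)[OF v(2,3)] by (rule less_le_trans)
    ultimately show "T (?i i) \<in> S \<and>
      ?g (?i i) \<in> carrier (ncps X) - {\<zero>\<^bsub>ncps X\<^esub>} \<and> ?h (?i i) \<in> carrier (ncps X) - {\<zero>\<^bsub>ncps X\<^esub>} \<and>
      (w, mt r (?g (?i i)) @ mt r (T (?i i)) @ mt r (?h (?i i))) \<in> r - Id"
      unfolding v(1)[symmetric] ncps_simps less_def
      using nf word_in_carrier[OF nf(1)] word_in_carrier[OF nf(2)] ncps_smult_closed by simp
  qed
  ultimately show ?thesis
    unfolding trivial_mod_def
    by (intro exI[of _ "?e ` ?N"] exI[of _ "\<lambda>i. ?g (?i i)"] exI[of _ "\<lambda>i. T (?i i)"]
        exI[of _ "\<lambda>i. ?h (?i i)"] conjI)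
qed

text \<open>The empty sum. It covers compositions that vanish, which a statement about nonzero
  elements of the closed ideal does not reach.\<close>

lemma trivial_mod_zero: "trivial_mod X r S w (\<lambda>w. 0)"
proof -
  have "(\<lambda>i. g i \<otimes>\<^bsub>ncps X\<^esub> s i \<otimes>\<^bsub>ncps X\<^esub> h i) \<in> ({} :: nat set) \<rightarrow> carrier (ncps X)" for g s h
    by simp
  note sum = has_topological_sum_ncps[OF finite_alphabet this]
  show ?thesis
    unfolding trivial_mod_def by (intro exI[of _ "{}"] exI) (simp add: sum)
qed

text \<open>A composition lies in the closed ideal, and the cancellation of its two leading terms
  leaves it either zero or with a leading word above w.\<close>

lemma trivial_mod_imp_compositions_trivial:
  assumes "\<And>f w. f \<in> J \<Longrightarrow> f \<noteq> (\<lambda>w. 0) \<Longrightarrow> w \<in> lists X \<Longrightarrow> less w (mt r f) \<Longrightarrow> trivial_mod X r S w f"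
  shows "compositions_trivial"
  unfolding compositions_trivial_def
proof (intro ballI allI impI)
  fix f g w c assume fg: "f \<in> S" "g \<in> S" and w: "w \<in> lists X" and c: "is_composition X r f g w c"
  from c fg obtain a b a' b' where ab: "a \<in> lists X" "b \<in> lists X" "a' \<in> lists X" "b' \<in> lists X"
    "w = a @ mt r f @ b" "w = a' @ mt r g @ b'" "c = (\<lambda>x. shift X a f b x - shift X a' g b' x)"
    by (rule composition_shifts)
  have J: "c \<in> J"
    unfolding ab(7) using shift_in_closed_ideal ab(1-4) fg by (intro J_diff) blast+
  show "trivial_mod X r S w c"
  proof (cases "c = (\<lambda>w. 0)")
    case True
    then show ?thesis using trivial_mod_zero by simp
  next
    case False
    then have "c (mt r c) \<noteq> 0" by (rule mt_nonzero[OF J_carrier[OF J]])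
    then have "less w (mt r c)"
      using shift_diff_less[OF fg ab(1-6), of "mt r c"] unfolding ab(7) by blast
    then show ?thesis using assms[OF J False w] by blast
  qed
qed

lemma GS_iff_compositions_trivial: "GS_basis X r S \<longleftrightarrow> compositions_trivial"
proof
  show "GS_basis X r S \<Longrightarrow> compositions_trivial"
    by (rule trivial_mod_imp_compositions_trivial) (rule GS_imp_trivial_mod)
  show "compositions_trivial \<Longrightarrow> GS_basis X r S"
    unfolding GS_basis_iff using mt_in_word_ideal by blast
qed

lemma GS_iff_trivial_mod:
  "GS_basis X r S \<longleftrightarrow> (\<forall>f\<in>J - {\<lambda>w. 0}. \<forall>w\<in>lists X. less w (mt r f) \<longrightarrow> trivial_mod X r S w f)"
  (is "_ \<longleftrightarrow> ?R")
proof
  assume GS: "GS_basis X r S"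
  show ?R using GS_imp_trivial_mod[OF GS] by simp
next
  assume R: ?R
  have compositions_trivial
  proof (rule trivial_mod_imp_compositions_trivial)
    fix f w assume "f \<in> J" "f \<noteq> (\<lambda>w. 0)" "w \<in> lists X" "less w (mt r f)"
    then show "trivial_mod X r S w f" using R by simp
  qed
  then show "GS_basis X r S" by (simp add: GS_iff_compositions_trivial)
qed

end

section \<open>The quotient algebra\<close>

context monic_set
begin

abbreviation A :: "('k, ('x list \<Rightarrow> 'k) set) module" where
  "A \<equiv> quot_algebra (ncps X) J"

abbreviation T_A :: "('x list \<Rightarrow> 'k) set topology" where
  "T_A \<equiv> quotient_topology (ncps_topology X) (quot_proj X S)"

lemma mem_proj_iff: "c \<in> quot_proj X S f \<longleftrightarrow> (\<exists>j\<in>J. c = (\<lambda>w. j w + f w))"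
  unfolding quot_proj_def a_r_coset_def' ncps_simps by blast

lemma proj_eq_iff:
  assumes "f \<in> carrier (ncps X)" "g \<in> carrier (ncps X)"
  shows "quot_proj X S f = quot_proj X S g \<longleftrightarrow> (\<lambda>w. f w - g w) \<in> J"
  using ring.quotient_eq_iff_same_a_r_cos[OF ring_ncps ideal_closed_ideal[OF finite_alphabet S_carrier] assms]
    ncps_minus[OF assms(2), of f]
  by (simp add: quot_proj_def)

lemma quot_carrier: "carrier A = quot_proj X S ` carrier (ncps X)"
  by (auto simp: quot_algebra_def FactRing_def A_RCOSETS_def' quot_proj_def)

lemma quot_add:
  assumes "f \<in> carrier (ncps X)" "g \<in> carrier (ncps X)"
  shows "quot_proj X S f \<oplus>\<^bsub>A\<^esub> quot_proj X S g = quot_proj X S (\<lambda>w. f w + g w)"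
  using ring_hom_add[OF ideal.rcos_ring_hom[OF ideal_closed_ideal[OF finite_alphabet S_carrier]] assms]
  by (simp add: quot_algebra_def quot_proj_def)

lemma quot_zero: "\<zero>\<^bsub>A\<^esub> = quot_proj X S (\<lambda>w. 0)"
proof -
  have "quot_proj X S (\<lambda>w. 0) = J"
    by (auto simp: mem_proj_iff)
  then show ?thesis by (simp add: quot_algebra_def FactRing_def)
qed

text \<open>Scalar multiplication on the quotient is a union over representatives. Its members
  coincide because the closed ideal is stable under scalars, so the union is a single coset.\<close>

lemma quot_smult:
  assumes f: "f \<in> carrier (ncps X)"
  shows "a \<odot>\<^bsub>A\<^esub> quot_proj X S f = quot_proj X S (\<lambda>w. a * f w)"
proof -
  have "quot_proj X S (\<lambda>w. a * c w) = quot_proj X S (\<lambda>w. a * f w)" if c: "c \<in> quot_proj X S f" for c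
  proof -
    obtain j where j: "j \<in> J" "c = (\<lambda>w. j w + f w)"
      using c unfolding mem_proj_iff by blast
    have "c \<in> carrier (ncps X)" unfolding j(2) by (rule ncps_add_closed[OF J_carrier[OF j(1)] f])
    moreover have "(\<lambda>w. a * c w - a * f w) \<in> J"
      using J_smult[OF j(1), of a] by (simp add: j(2) algebra_simps)
    ultimately show ?thesis using proj_eq_iff[OF ncps_smult_closed ncps_smult_closed] f by blast
  qed
  moreover have "f \<in> quot_proj X S f"
    unfolding mem_proj_iff by (rule bexI[OF _ J_zero]) simp
  ultimately have "(\<Union>c\<in>quot_proj X S f. quot_proj X S (\<lambda>w. a * c w)) = quot_proj X S (\<lambda>w. a * f w)"
    by blast
  then show ?thesis by (simp add: quot_algebra_def quot_proj_def)
qed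

lemma abelian_monoid_quot: "abelian_monoid A"
  by (rule abelian_monoidI)
    (auto simp: quot_carrier quot_add quot_zero ncps_add_closed ac_simps)

lemma quot_finsum:
  assumes "finite F" "\<And>i. i \<in> F \<Longrightarrow> b i \<in> carrier (ncps X)" "\<And>i. i \<in> F \<Longrightarrow> b' i = quot_proj X S (b i)"
  shows "finsum A b' F = quot_proj X S (\<lambda>w. \<Sum>i\<in>F. b i w)"
proof -
  interpret A: abelian_monoid A by (rule abelian_monoid_quot)
  show ?thesis
    using assms
  proof (induction F)
    case (insert x F)
    have "b' i \<in> carrier A" if "i \<in> insert x F" for i
      unfolding quot_carrier using insert.prems that by blast
    then have "finsum A b' (insert x F) = b' x \<oplus>\<^bsub>A\<^esub> finsum A b' F"
      by (intro A.finsum_insert insert.hyps) auto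
    also have "\<dots> = quot_proj X S (\<lambda>w. b x w + (\<Sum>i\<in>F. b i w))"
      using insert by (simp add: quot_add ncps_sum_closed)
    finally show ?case using insert.hyps by simp
  qed (simp add: quot_zero)
qed

text \<open>A neighbourhood basis of the class of f consists of the images of the sets f + J + I^n,
  with I the augmentation ideal, so convergence is tested modulo both J and I^n.\<close>

lemma has_topological_sum_quot:
  assumes b: "\<And>i. i \<in> I \<Longrightarrow> b i \<in> carrier (ncps X)" "\<And>i. i \<in> I \<Longrightarrow> b' i = quot_proj X S (b i)"
    and f: "f \<in> carrier (ncps X)"
  shows "has_topological_sum A T_A b' I (quot_proj X S f) \<longleftrightarrow>
    (\<forall>n. \<exists>F. finite F \<and> F \<subseteq> I \<and> (\<forall>F'. finite F' \<and> F \<subseteq> F' \<and> F' \<subseteq> I \<longrightarrow>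
      (\<exists>j\<in>J. agree n (\<lambda>w. (\<Sum>i\<in>F'. b i w) - f w) j)))"
    (is "_ \<longleftrightarrow> (\<forall>n. \<exists>F. ?P n F)")
proof
  note X = finite_alphabet
  have fin: "finsum A b' F = quot_proj X S (\<lambda>w. \<Sum>i\<in>F. b i w)"
    "(\<lambda>w. \<Sum>i\<in>F. b i w) \<in> carrier (ncps X)" if "finite F" "F \<subseteq> I" for F
  proof -
    show "finsum A b' F = quot_proj X S (\<lambda>w. \<Sum>i\<in>F. b i w)"
      using that b by (intro quot_finsum) blast+
    show "(\<lambda>w. \<Sum>i\<in>F. b i w) \<in> carrier (ncps X)"
      using that b(1) by (intro ncps_sum_closed) blast
  qed
  {
    assume L: "has_topological_sum A T_A b' I (quot_proj X S f)"
    show "\<forall>n. \<exists>F. ?P n F"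
    proof
      fix n
      \<comment> \<open>This set is f + J + I^n. Being a union of cosets of J, it is the full
        preimage of its image, so the image is open in the quotient.\<close>
      define V where "V = {g \<in> carrier (ncps X). \<exists>j\<in>J. agree n (\<lambda>w. g w - f w) j}"
      have V: "quot_proj X S g \<in> quot_proj X S ` V \<longleftrightarrow> g \<in> V" if g: "g \<in> carrier (ncps X)" for g
      proof
        assume "quot_proj X S g \<in> quot_proj X S ` V"
        then obtain h j where h: "h \<in> carrier (ncps X)" "quot_proj X S g = quot_proj X S h"
          "j \<in> J" "agree n (\<lambda>w. h w - f w) j" unfolding V_def by blast
        then have "(\<lambda>w. g w - h w) \<in> J" using proj_eq_iff[OF g h(1)] by simp
        then have "(\<lambda>w. (g w - h w) + j w) \<in> J" using h(3) by (rule J_add)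
        moreover have "agree n (\<lambda>w. g w - f w) (\<lambda>w. (g w - h w) + j w)"
          using h(4) by (auto simp: agree_def algebra_simps)
        ultimately show "g \<in> V" unfolding V_def using g by blast
      qed blast
      have "openin (ncps_topology X) V"
        unfolding openin_ncps_topology[OF X]
      proof (intro conjI ballI)
        fix g assume g: "g \<in> V"
        have "h \<in> V" if h: "h \<in> carrier (ncps X)" "agree n h g" for h
        proof -
          obtain j where j: "j \<in> J" "agree n (\<lambda>w. g w - f w) j" using g unfolding V_def by blast
          have "agree n (\<lambda>w. h w - f w) j" using j(2) h(2) by (simp add: agree_def)
          with j(1) h(1) show ?thesis unfolding V_def by blast
        qed
        then show "\<exists>n. \<forall>h\<in>carrier (ncps X). agree n h g \<longrightarrow> h \<in> V" by blast
      qed (simp add: V_def)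
      moreover have "{g \<in> carrier (ncps X). quot_proj X S g \<in> quot_proj X S ` V} = V"
        using V unfolding V_def by blast
      ultimately have "openin T_A (quot_proj X S ` V)"
        unfolding openin_quotient_topology topspace_ncps_topology[OF X] by (auto simp: V_def)
      moreover have "f \<in> V" unfolding V_def using f J_zero by (auto intro!: bexI[of _ "\<lambda>w. 0"])
      ultimately obtain F where F: "finite F" "F \<subseteq> I"
        "\<forall>F'. finite F' \<and> F \<subseteq> F' \<and> F' \<subseteq> I \<longrightarrow> finsum A b' F' \<in> quot_proj X S ` V"
        using L unfolding has_topological_sum_iff by blast
      have "\<exists>j\<in>J. agree n (\<lambda>w. (\<Sum>i\<in>F'. b i w) - f w) j" if F': "finite F' \<and> F \<subseteq> F' \<and> F' \<subseteq> I" for F'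
      proof -
        have "quot_proj X S (\<lambda>w. \<Sum>i\<in>F'. b i w) \<in> quot_proj X S ` V"
          using F(3)[rule_format, OF F'] fin(1) F' by simp
        then have "(\<lambda>w. \<Sum>i\<in>F'. b i w) \<in> V" using V fin(2) F' by blast
        then show ?thesis unfolding V_def by blast
      qed
      then have "?P n F" using F(1,2) by blast
      then show "\<exists>F. ?P n F" ..
    qed
  next
    assume R: "\<forall>n. \<exists>F. ?P n F"
    show "has_topological_sum A T_A b' I (quot_proj X S f)"
      unfolding has_topological_sum_iff
    proof (intro conjI allI impI)
      have "topspace T_A = quot_proj X S ` carrier (ncps X)"
        using quotient_imp_surjective_map[OF quotient_map_quotient_topology] topspace_ncps_topology[OF X]
        by metis
      then show "quot_proj X S f \<in> topspace T_A" using f by blast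
    next
      fix U assume U: "openin T_A U \<and> quot_proj X S f \<in> U"
      then have "openin (ncps_topology X) {g \<in> carrier (ncps X). quot_proj X S g \<in> U}"
        unfolding openin_quotient_topology topspace_ncps_topology[OF X] by blast
      then have "\<exists>n. \<forall>g\<in>carrier (ncps X). agree n g f \<longrightarrow> g \<in> {g \<in> carrier (ncps X). quot_proj X S g \<in> U}"
        unfolding openin_ncps_topology[OF X] by (elim conjE bspec) (use f U in simp)
      then obtain n where n: "\<forall>g\<in>carrier (ncps X). agree n g f \<longrightarrow> quot_proj X S g \<in> U"
        by auto
      from R have "\<exists>F. ?P n F" by (rule spec)
      then obtain F where F: "?P n F" ..
      have "finsum A b' F' \<in> U" if F': "finite F' \<and> F \<subseteq> F' \<and> F' \<subseteq> I" for F'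
      proof -
        let ?s = "\<lambda>w. \<Sum>i\<in>F'. b i w"
        have s: "finsum A b' F' = quot_proj X S ?s" "?s \<in> carrier (ncps X)"
          using fin[of F'] F' by simp_all
        obtain j where j: "j \<in> J" "agree n (\<lambda>w. ?s w - f w) j"
          using F[THEN conjunct2, THEN conjunct2, rule_format, OF F'] by blast
        \<comment> \<open>Subtracting j keeps the class of the partial sum and moves its
          representative into the neighbourhood of f.\<close>
        have sj: "(\<lambda>w. ?s w - j w) \<in> carrier (ncps X)" by (rule ncps_diff_closed[OF s(2) J_carrier[OF j(1)]])
        have "agree n (\<lambda>w. ?s w - j w) f"
          unfolding agree_def
        proof (intro allI impI)
          fix w :: "'x list" assume "length w < n"
          then have "?s w - f w = j w" by (rule agreeD[OF j(2)])
          then show "?s w - j w = f w" by (simp add: algebra_simps)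
        qed
        then have "quot_proj X S (\<lambda>w. ?s w - j w) \<in> U" using n sj by blast
        moreover have "quot_proj X S (\<lambda>w. ?s w - j w) = quot_proj X S ?s"
          unfolding proj_eq_iff[OF sj s(2)] using J_uminus[OF j(1)] by simp
        ultimately show ?thesis using s(1) by simp
      qed
      then show "\<exists>F. finite F \<and> F \<subseteq> I \<and> (\<forall>F'. finite F' \<and> F \<subseteq> F' \<and> F' \<subseteq> I \<longrightarrow> finsum A b' F' \<in> U)"
        using F by (intro exI[of _ F]) simp
    qed
  }
qed

text \<open>Any family of coefficients on words is summable, with the series of these coefficients
  as its sum. Since J is closed, the classes sum to that of f exactly when this series is congruent
  to f. Values of the family outside B are arbitrary, hence the truncation.\<close>

lemma has_topological_sum_words:
  assumes B: "B \<subseteq> lists X" and f: "f \<in> carrier (ncps X)"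
  shows "has_topological_sum A T_A (\<lambda>w. \<alpha> w \<odot>\<^bsub>A\<^esub> quot_proj X S (word w)) B (quot_proj X S f) \<longleftrightarrow>
    (\<lambda>w. (if w \<in> B then \<alpha> w else 0) - f w) \<in> J"
proof -
  let ?h = "\<lambda>w. if w \<in> B then \<alpha> w else 0"
  have h: "(\<lambda>w. ?h w - f w) \<in> carrier (ncps X)"
    using B f by (intro ncps_diff_closed) (auto simp: ncps_carrier_iff)
  have b: "(\<lambda>w. \<alpha> i * word i w) \<in> carrier (ncps X)"
    "\<alpha> i \<odot>\<^bsub>A\<^esub> quot_proj X S (word i) = quot_proj X S (\<lambda>w. \<alpha> i * word i w)" if "i \<in> B" for i
  proof -
    have "i \<in> lists X" using that B by blast
    note word = word_in_carrier[OF this]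
    show "(\<lambda>w. \<alpha> i * word i w) \<in> carrier (ncps X)" by (rule ncps_smult_closed[OF word])
    show "\<alpha> i \<odot>\<^bsub>A\<^esub> quot_proj X S (word i) = quot_proj X S (\<lambda>w. \<alpha> i * word i w)"
      by (rule quot_smult[OF word])
  qed
  have sum: "(\<Sum>i\<in>F. \<alpha> i * word i w) = (if w \<in> F then \<alpha> w else 0)" if "finite F" for F w
  proof -
    have "(\<Sum>i\<in>F. \<alpha> i * word i w) = (\<Sum>i\<in>F. if i = w then \<alpha> w else 0)"
      by (rule sum.cong) (auto simp: word_def)
    then show ?thesis using that by simp
  qed
  define B_n where "B_n n = {w \<in> B. length w < n}" for n
  have B_n: "finite (B_n n)" "B_n n \<subseteq> B" for n
    using finite_subset[OF _ finite_short_words[OF finite_alphabet, of n], of "B_n n"] B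
    by (auto simp: B_n_def)
  have agree: "agree n (\<lambda>w. (\<Sum>i\<in>F. \<alpha> i * word i w) - f w) (\<lambda>w. ?h w - f w)"
    if "finite F" "B_n n \<subseteq> F" "F \<subseteq> B" for n F
    using that unfolding agree_def sum[OF that(1)] B_n_def by auto
  show ?thesis
  proof (rule trans[OF has_topological_sum_quot[OF b f] iffI])
    assume J: "(\<lambda>w. ?h w - f w) \<in> J"
    show "\<forall>n. \<exists>F. finite F \<and> F \<subseteq> B \<and> (\<forall>F'. finite F' \<and> F \<subseteq> F' \<and> F' \<subseteq> B \<longrightarrow>
      (\<exists>j\<in>J. agree n (\<lambda>w. (\<Sum>i\<in>F'. \<alpha> i * word i w) - f w) j))"
    proof
      fix n
      show "\<exists>F. finite F \<and> F \<subseteq> B \<and> (\<forall>F'. finite F' \<and> F \<subseteq> F' \<and> F' \<subseteq> B \<longrightarrow>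
        (\<exists>j\<in>J. agree n (\<lambda>w. (\<Sum>i\<in>F'. \<alpha> i * word i w) - f w) j))"
        using B_n[of n] J agree by (intro exI[of _ "B_n n"]) blast
    qed
  next
    assume L: "\<forall>n. \<exists>F. finite F \<and> F \<subseteq> B \<and> (\<forall>F'. finite F' \<and> F \<subseteq> F' \<and> F' \<subseteq> B \<longrightarrow>
      (\<exists>j\<in>J. agree n (\<lambda>w. (\<Sum>i\<in>F'. \<alpha> i * word i w) - f w) j))"
    show "(\<lambda>w. ?h w - f w) \<in> J"
    proof (rule J_limit[OF h])
      fix n
      obtain F where F: "finite F" "F \<subseteq> B" "\<forall>F'. finite F' \<and> F \<subseteq> F' \<and> F' \<subseteq> B \<longrightarrow>
          (\<exists>j\<in>J. agree n (\<lambda>w. (\<Sum>i\<in>F'. \<alpha> i * word i w) - f w) j)"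
        using spec[OF L, of n] by (elim exE conjE)
      \<comment> \<open>Enlarging F by the short words of B makes the partial sum agree with the
        full series up to length n as well.\<close>
      let ?F = "F \<union> B_n n"
      have F': "finite ?F \<and> F \<subseteq> ?F \<and> ?F \<subseteq> B" using F(1,2) B_n by blast
      obtain j where j: "j \<in> J" "agree n (\<lambda>w. (\<Sum>i\<in>?F. \<alpha> i * word i w) - f w) j"
        using F(3)[rule_format, OF F'] by (elim bexE)
      have "agree n (\<lambda>w. ?h w - f w) (\<lambda>w. (\<Sum>i\<in>?F. \<alpha> i * word i w) - f w)"
        by (rule agree_sym, rule agree) (use F' in simp_all)
      then show "\<exists>j\<in>J. agree n (\<lambda>w. ?h w - f w) j"
        by (intro bexI[of _ j] j(1)) (rule agree_trans[OF _ j(2)])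
    qed
  qed
qed

text \<open>For every monic set, \<open>normal_form\<close> already provides an expansion of each
  class, so only uniqueness carries information.\<close>

lemma GS_iff_topological_basis:
  "GS_basis X r S \<longleftrightarrow>
    topological_basis_on A T_A (\<lambda>w. quot_proj X S (word w)) (lists X - reducible)"
proof
  let ?B = "lists X - reducible"
  let ?sum = "\<lambda>\<alpha> f. has_topological_sum A T_A (\<lambda>w. \<alpha> w \<odot>\<^bsub>A\<^esub> quot_proj X S (word w)) ?B (quot_proj X S f)"
  have sum_iff: "?sum \<alpha> f \<longleftrightarrow> (\<lambda>w. (if w \<in> ?B then \<alpha> w else 0) - f w) \<in> J"
    if "f \<in> carrier (ncps X)" for \<alpha> f
    by (rule has_topological_sum_words[OF Diff_subset that])
  \<comment> \<open>Subtracting g clears the reducible words without changing the class, and what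
    remains supplies the coefficients.\<close>
  have expand: "?sum (restrict (\<lambda>w. f w - g w) ?B) f"
    if f: "f \<in> carrier (ncps X)" and g: "g \<in> J" "\<And>w. w \<in> reducible \<Longrightarrow> g w = f w" for f g
  proof -
    have eq: "(\<lambda>w. (if w \<in> ?B then restrict (\<lambda>w. f w - g w) ?B w else 0) - f w) = (\<lambda>w. - g w)"
    proof
      fix w
      show "(if w \<in> ?B then restrict (\<lambda>w. f w - g w) ?B w else 0) - f w = - g w"
        using g(2)[of w] f J_carrier[OF g(1)] by (cases "w \<in> lists X") (auto simp: ncps_carrier_iff)
    qed
    show ?thesis unfolding sum_iff[OF f] eq by (rule J_uminus[OF g(1)])
  qed
  {
    assume GS: "GS_basis X r S"
    show "topological_basis_on A T_A (\<lambda>w. quot_proj X S (word w)) ?B"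
      unfolding topological_basis_on_def
    proof (intro conjI ballI)
      show "(\<lambda>w. quot_proj X S (word w)) \<in> ?B \<rightarrow> carrier A"
        unfolding quot_carrier by (intro Pi_I imageI word_in_carrier) (rule DiffD1)
    next
      fix m assume "m \<in> carrier A"
      then obtain f where f: "f \<in> carrier (ncps X)" "m = quot_proj X S f" unfolding quot_carrier by blast
      obtain g where g: "g \<in> J" "\<And>w. w \<in> reducible \<Longrightarrow> g w = f w"
        by (rule normal_form[OF f(1)]) blast
      show "\<exists>!\<alpha>. \<alpha> \<in> extensional ?B \<and>
          has_topological_sum A T_A (\<lambda>w. \<alpha> w \<odot>\<^bsub>A\<^esub> quot_proj X S (word w)) ?B m"
      proof (rule ex_ex1I)
        show "\<exists>\<alpha>. \<alpha> \<in> extensional ?B \<and>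
            has_topological_sum A T_A (\<lambda>w. \<alpha> w \<odot>\<^bsub>A\<^esub> quot_proj X S (word w)) ?B m"
          unfolding f(2) by (rule exI, rule conjI[OF restrict_extensional expand[OF f(1) g]])
      next
        fix \<alpha> \<alpha>' assume \<alpha>: "\<alpha> \<in> extensional ?B \<and>
            has_topological_sum A T_A (\<lambda>w. \<alpha> w \<odot>\<^bsub>A\<^esub> quot_proj X S (word w)) ?B m"
          and \<alpha>': "\<alpha>' \<in> extensional ?B \<and>
            has_topological_sum A T_A (\<lambda>w. \<alpha>' w \<odot>\<^bsub>A\<^esub> quot_proj X S (word w)) ?B m"
        \<comment> \<open>The difference of two expansions is an element of J supported on
          irreducible words; its leading word would have to be reducible as well.\<close>
        let ?h = "\<lambda>w. if w \<in> ?B then \<alpha> w - \<alpha>' w else 0"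
        have "(\<lambda>w. (if w \<in> ?B then \<alpha> w else 0) - f w) \<in> J"
          "(\<lambda>w. (if w \<in> ?B then \<alpha>' w else 0) - f w) \<in> J"
          using conjunct2[OF \<alpha>] conjunct2[OF \<alpha>'] unfolding f(2) sum_iff[OF f(1)] .
        then have "(\<lambda>w. ((if w \<in> ?B then \<alpha> w else 0) - f w) - ((if w \<in> ?B then \<alpha>' w else 0) - f w)) \<in> J"
          by (rule J_diff)
        also have "(\<lambda>w. ((if w \<in> ?B then \<alpha> w else 0) - f w) - ((if w \<in> ?B then \<alpha>' w else 0) - f w)) = ?h"
          by auto
        finally have h: "?h \<in> J" .
        have "?h = (\<lambda>w. 0)"
        proof (rule ccontr)
          assume nz: "?h \<noteq> (\<lambda>w. 0)"
          then have "mt r ?h \<in> reducible" using GS h unfolding GS_basis_iff by blast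
          moreover have "?h (mt r ?h) \<noteq> 0" by (rule mt_nonzero[OF J_carrier[OF h] nz])
          ultimately show False by simp
        qed
        then have "\<alpha> w = \<alpha>' w" if "w \<in> ?B" for w
          using that fun_cong[of ?h "\<lambda>w. 0" w] by simp
        then show "\<alpha> = \<alpha>'"
          by (rule extensionalityI[OF conjunct1[OF \<alpha>] conjunct1[OF \<alpha>']])
      qed
    qed
  next
    assume basis: "topological_basis_on A T_A (\<lambda>w. quot_proj X S (word w)) ?B"
    show "GS_basis X r S"
      unfolding GS_basis_iff
    proof (intro ballI impI, rule ccontr)
      fix f assume f: "f \<in> J" "f \<noteq> (\<lambda>w. 0)" and m: "mt r f \<notin> reducible"
      note fc = J_carrier[OF f(1)]
      obtain g where g: "g \<in> J" "\<And>w. w \<in> reducible \<Longrightarrow> g w = f w" "g (mt r f) = 0"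
        by (rule normal_form[OF fc]) (use m in blast)
      have mB: "mt r f \<in> ?B" using m mt_word[OF fc f(2)] by blast
      have eq: "(\<lambda>w. (if w \<in> ?B then restrict (\<lambda>w. 0) ?B w else 0) - f w) = (\<lambda>w. - f w)"
        by auto
      \<comment> \<open>The class of f is zero and would have two expansions: the zero family, and
        the coefficients of f - g. The latter is nonzero at the irreducible word
        \<open>mt r f\<close>, since g vanishes there.\<close>
      have zero: "?sum (restrict (\<lambda>w. 0) ?B) f"
        unfolding sum_iff[OF fc] eq by (rule J_uminus[OF f(1)])
      have diff: "?sum (restrict (\<lambda>w. f w - g w) ?B) f" by (rule expand[OF fc g(1,2)])
      have "\<exists>!\<alpha>. \<alpha> \<in> extensional ?B \<and> ?sum \<alpha> f"
        using basis fc unfolding topological_basis_on_def quot_carrier by simp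
      then obtain \<alpha> where \<alpha>: "\<forall>\<beta>. \<beta> \<in> extensional ?B \<and> ?sum \<beta> f \<longrightarrow> \<beta> = \<alpha>"
        by (rule ex1E)
      have "restrict (\<lambda>w. 0) ?B = \<alpha>" "restrict (\<lambda>w. f w - g w) ?B = \<alpha>"
        by (rule mp[OF spec[OF \<alpha>]], rule conjI[OF restrict_extensional zero],
            rule mp[OF spec[OF \<alpha>]], rule conjI[OF restrict_extensional diff])
      then have "restrict (\<lambda>w. 0) ?B = restrict (\<lambda>w. f w - g w) ?B" by simp
      from fun_cong[OF this, of "mt r f"] have "f (mt r f) = 0" using mB g(3) by simp
      then show False using mt_nonzero[OF fc f(2)] by blast
    qed
  }
qed

end

theorem theorem2p9:
  fixes X :: "'x set"
    and r :: "'x list rel"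
    and S :: "('x list \<Rightarrow> 'k :: {comm_ring, comm_monoid_mult}) set"
  assumes "finite X"
    and "admissible_order X r"
    and "N_order_on (lists X) r"
    and "S \<subseteq> carrier (ncps X)"
    and "\<forall>s\<in>S. monic r s"
  shows
    "(GS_basis X r S \<longleftrightarrow>
       (\<forall>f\<in>S. \<forall>g\<in>S. \<forall>w\<in>lists X. \<forall>c.
          is_composition X r f g w c \<longrightarrow> trivial_mod X r S w c)) \<and>
     (GS_basis X r S \<longleftrightarrow>
       (\<forall>f\<in>closed_ideal X S - {\<zero>\<^bsub>ncps X\<^esub>}. \<forall>w\<in>lists X.
          (w, mt r f) \<in> r - Id \<longrightarrow> trivial_mod X r S w f)) \<and>
     (GS_basis X r S \<longleftrightarrow>
       topological_basis_on
         (quot_algebra (ncps X) (closed_ideal X S))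
         (quotient_topology (ncps_topology X) (quot_proj X S))
         (\<lambda>w. quot_proj X S (word w))
         (lists X - word_ideal X (mt r ` S)))"
proof -
  interpret monic_set X r S by unfold_locales (use assms in auto)
  show ?thesis
    using GS_iff_compositions_trivial GS_iff_trivial_mod GS_iff_topological_basis
    unfolding compositions_trivial_def less_def ncps_simps by (intro conjI)
qed

end
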